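(* Let $r\le s$ be positive integers, let $X=(x_{i,j})$ be an $r\times s$ matrix of distinct indeterminates, $K$ an $F$-finite field of characteristic $p>0$, and $R=K[X]$. For every integer $t$ with $1\le t\le r$, the ideal $I_t(X)$ generated by the $t\times t$ minors of $X$ is symbolic $F$-split.
   Context: For an ideal $I$ of $R$ and $n\ge0$, $I^{(n)}=I^nR_S\cap R$, where $S$ is the complement of the union of the minimal primes of $I$. The ideal $I$ is called symbolic $F$-split if there is an $R$-linear map $\phi:R^{1/p}\to R$ with $\phi|_R=\mathrm{id}_R$ (a splitting of the inclusion $R\subseteq R^{1/p}$) such that $\phi\big((I^{(np+1)})^{1/p}\big)\subseteq I^{(n+1)}$ for every $n\ge0$, where $R^{1/p}$ is the ring of $p$-th roots of elements of $R$ and $J^{1/p}=\{f^{1/p}\mid f\in J\}$. A field $K$ of characteristic $p$ is $F$-finite if $[K:K^p]<\infty$. *)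

theory Defs
  imports
    "HOL-Library.Poly_Mapping"
    "HOL-Algebra.Ideal_Product"
    "HOL-Algebra.Embedded_Algebras"
    "HOL-Algebra.Algebraic_Closure_Type"
    "HOL-Computational_Algebra.Computational_Algebra"
    "Jordan_Normal_Form.Determinant"
    "Jordan_Normal_Form.DL_Submatrix"
begin

text \<open>
  For a type of indeterminates \<open>'v\<close>, the polynomial ring \<open>K['v]\<close> is the monoid algebra
  \<open>('v \<Rightarrow>\<^sub>0 nat) \<Rightarrow>\<^sub>0 'k\<close>. The library provides its \<open>idom\<close> instance for linearly ordered
  \<open>'v\<close>; the order plays no other role. Ideals of a type-class ring are those of
  \<^const>\<open>ring_of_type_algebra\<close>.
\<close>

definition indet :: "'v \<Rightarrow> ('v \<Rightarrow>\<^sub>0 nat) \<Rightarrow>\<^sub>0 'k::field" where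
  "indet v = Poly_Mapping.single (Poly_Mapping.single v 1) 1"

definition minors :: "nat \<Rightarrow> 'a::comm_ring_1 mat \<Rightarrow> 'a set" where
  "minors t A = {det (submatrix A I J) | I J.
     I \<subseteq> {..<dim_row A} \<and> J \<subseteq> {..<dim_col A} \<and> card I = t \<and> card J = t}"

definition det_ideal :: "nat \<Rightarrow> 'a::comm_ring_1 mat \<Rightarrow> 'a set" where
  "det_ideal t A = genideal ring_of_type_algebra (minors t A)"

definition F_finite :: "nat \<Rightarrow> 'k::field itself \<Rightarrow> bool" where
  "F_finite p _ \<longleftrightarrow>
     ring.finite_dimension (ring_of_type_algebra :: 'k ring) (range (\<lambda>x. x ^ p)) UNIV"

definition minimal_primes :: "'a::comm_ring_1 set \<Rightarrow> 'a set set" where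
  "minimal_primes I = {P. primeideal P ring_of_type_algebra \<and> I \<subseteq> P \<and>
     (\<forall>Q. primeideal Q ring_of_type_algebra \<and> I \<subseteq> Q \<and> Q \<subseteq> P \<longrightarrow> Q = P)}"

text \<open>
  For a domain \<open>R\<close>, the localization \<open>R\<^sub>S\<close> at a multiplicative set \<open>S\<close> not containing \<open>0\<close> is
  the subring of fractions with denominator in \<open>S\<close> of the fraction field, and \<open>J R\<^sub>S\<close> is
  the ideal of that subring generated by the image of \<open>J\<close>.
\<close>

definition localization :: "'a::idom set \<Rightarrow> 'a fract ring" where
  "localization S = ring_of_type_algebra\<lparr>carrier := {Fract a s | a s. s \<in> S}\<rparr>"

definition symbolic_power :: "'a::idom set \<Rightarrow> nat \<Rightarrow> 'a set" where
  "symbolic_power I n =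
     {x. to_fract x \<in> genideal (localization (- \<Union>(minimal_primes I)))
                        (to_fract ` (I [^]\<^bsub>ideals_set ring_of_type_algebra\<^esub> n))}"

text \<open>
  \<open>pth_roots p A\<close> is \<open>A\<^sup>1\<^sup>/\<^sup>p\<close>, realized inside the algebraic closure of the fraction field of
  \<open>R\<close>; in particular \<open>pth_roots p UNIV\<close> is \<open>R\<^sup>1\<^sup>/\<^sup>p\<close>. In characteristic \<open>p\<close> every element of
  \<open>R\<close> has exactly one \<open>p\<close>-th root there.
\<close>

definition base_emb :: "'a::idom \<Rightarrow> 'a fract alg_closure" where
  "base_emb f = to_ac (to_fract f)"

definition pth_roots :: "nat \<Rightarrow> 'a::idom set \<Rightarrow> 'a fract alg_closure set" where
  "pth_roots p A = {y. \<exists>f\<in>A. y ^ p = base_emb f}"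

text \<open>The values of \<open>\<phi>\<close> outside \<open>R\<^sup>1\<^sup>/\<^sup>p\<close> are irrelevant.\<close>

definition linear_on_pth_roots :: "nat \<Rightarrow> ('a::idom fract alg_closure \<Rightarrow> 'a) \<Rightarrow> bool" where
  "linear_on_pth_roots p \<phi> \<longleftrightarrow>
     (\<forall>y\<in>pth_roots p UNIV. \<forall>z\<in>pth_roots p UNIV. \<phi> (y + z) = \<phi> y + \<phi> z) \<and>
     (\<forall>a. \<forall>y\<in>pth_roots p UNIV. \<phi> (base_emb a * y) = a * \<phi> y)"

definition symbolic_F_split :: "nat \<Rightarrow> 'a::idom set \<Rightarrow> bool" where
  "symbolic_F_split p I \<longleftrightarrow>
     (\<exists>\<phi>. linear_on_pth_roots p \<phi> \<and> (\<forall>a. \<phi> (base_emb a) = a) \<and>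
          (\<forall>n. \<phi> ` pth_roots p (symbolic_power I (n * p + 1)) \<subseteq> symbolic_power I (n + 1)))"

end

theory Submission
  imports Defs "HOL-Library.Nat_Bijection"
begin

text \<open>
  Put \<open>m = t - 1\<close> and let \<open>Q\<close> be the kernel of the map \<open>K[X] \<rightarrow> K[Y, Z]\<close> that sends \<open>X\<close> to the product of
  generic matrices of sizes \<open>r \<times> m\<close> and \<open>m \<times> s\<close>. Over the residue field of a prime \<open>P \<supseteq> I\<^sub>t\<close> the
  matrix \<open>X\<close> has rank at most \<open>m\<close> and so factors; hence \<open>Q \<subseteq> P\<close>, and \<open>Q\<close> is the only minimal prime
  of \<open>I\<^sub>t\<close>. The leading \<open>m\<close>-minor \<open>\<Delta>\<close> is not in \<open>Q\<close>, and after inverting it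
  \<open>X = A B + G\<close> with inner dimension \<open>m\<close> and with the bordered \<open>t\<close>-minors as entries of \<open>G\<close>, up to units.
  Therefore \<open>I\<^sub>t\<close> is generated near \<open>Q\<close> by \<open>h = (r - m) (s - m)\<close> elements, and every \<open>a\<close>-minor lies in the
  symbolic power of exponent \<open>a - m\<close>.

  Let \<open>f\<close> be the product of the minors along all diagonals of \<open>X\<close>. It lies in the \<open>h\<close>-th symbolic
  power, and its dominating monomial for a suitable weight is the product of all indeterminates. The
  latter makes \<open>T (f\<^sup>p\<^sup>-\<^sup>1 \<cdot> _)\<close> a splitting, \<open>T\<close> being the trace map; the former and the
  pigeonhole principle for \<open>h\<close> local generators give its compatibility with symbolic powers.
\<close>

section \<open>Ideals of a commutative ring and their powers\<close>

abbreviation type_ideal :: "'a::comm_ring_1 set \<Rightarrow> bool" where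
  "type_ideal K \<equiv> ideal K ring_of_type_algebra"

lemma rta_simps [simp]:
  "carrier ring_of_type_algebra = UNIV"
  "monoid.mult ring_of_type_algebra = (*)" "one ring_of_type_algebra = 1"
  "zero ring_of_type_algebra = 0" "add ring_of_type_algebra = (+)"
  by (auto simp: ring_of_type_algebra_def)

lemma type_ideal_iff:
  fixes K :: "'a::comm_ring_1 set"
  shows "type_ideal K \<longleftrightarrow> 0 \<in> K \<and> (\<forall>x\<in>K. \<forall>y\<in>K. x + y \<in> K) \<and> (\<forall>r. \<forall>x\<in>K. r * x \<in> K)"
proof
  assume *: "type_ideal K"
  interpret ideal K "ring_of_type_algebra :: 'a ring" by fact
  have "0 \<in> K" using additive_subgroup.zero_closed[OF is_additive_subgroup] unfolding rta_simps .
  moreover have "x + y \<in> K" if "x \<in> K" "y \<in> K" for x y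
    using additive_subgroup.a_closed[OF is_additive_subgroup that] unfolding rta_simps .
  moreover have "r * x \<in> K" if "x \<in> K" for r x
    using I_l_closed[OF that, of r] by simp
  ultimately show "0 \<in> K \<and> (\<forall>x\<in>K. \<forall>y\<in>K. x + y \<in> K) \<and> (\<forall>r. \<forall>x\<in>K. r * x \<in> K)"
    by blast
next
  assume *: "0 \<in> K \<and> (\<forall>x\<in>K. \<forall>y\<in>K. x + y \<in> K) \<and> (\<forall>r. \<forall>x\<in>K. r * x \<in> K)"
  interpret ring "ring_of_type_algebra :: 'a ring" by (rule ring_from_type_algebra)
  have inv: "inv\<^bsub>add_monoid (ring_of_type_algebra :: 'a ring)\<^esub> x = - x" for x :: 'a
    using a_inv_def[of "ring_of_type_algebra :: 'a ring"] minus_equality[of "-x" x] by simp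
  have neg: "- x \<in> K" if "x \<in> K" for x
    using * that by (metis mult_minus1)
  show "type_ideal K"
  proof (rule idealI)
    show "subgroup K (add_monoid (ring_of_type_algebra :: 'a ring))"
      unfolding subgroup_def using * neg inv by auto
    show "ring (ring_of_type_algebra :: 'a ring)" by (rule ring_axioms)
    fix a x assume "a \<in> K" "x \<in> carrier (ring_of_type_algebra :: 'a ring)"
    then have "x * a \<in> K" using * by blast
    then show "x \<otimes>\<^bsub>ring_of_type_algebra\<^esub> a \<in> K" "a \<otimes>\<^bsub>ring_of_type_algebra\<^esub> x \<in> K"
      by (simp_all add: mult.commute)
  qed
qed

lemma type_ideal_0: "type_ideal K \<Longrightarrow> 0 \<in> K"
  and type_ideal_add: "type_ideal K \<Longrightarrow> x \<in> K \<Longrightarrow> y \<in> K \<Longrightarrow> x + y \<in> K"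
  and type_ideal_mult: "type_ideal K \<Longrightarrow> x \<in> K \<Longrightarrow> r * x \<in> K"
  and type_ideal_mult2: "type_ideal K \<Longrightarrow> x \<in> K \<Longrightarrow> x * r \<in> K"
  and type_ideal_uminus: "type_ideal K \<Longrightarrow> x \<in> K \<Longrightarrow> - x \<in> K"
proof -
  assume K: "type_ideal K"
  show 0: "0 \<in> K" and add: "x \<in> K \<Longrightarrow> y \<in> K \<Longrightarrow> x + y \<in> K"
    and mult: "x \<in> K \<Longrightarrow> r * x \<in> K" for x y r
    using K by (simp_all add: type_ideal_iff)
  show "x \<in> K \<Longrightarrow> x * r \<in> K" using mult[of x r] by (simp add: mult.commute)
  show "x \<in> K \<Longrightarrow> - x \<in> K" using mult[of x "-1"] by simp
qed

lemma type_ideal_sum: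
  assumes "type_ideal K" "\<And>i. i \<in> A \<Longrightarrow> f i \<in> K"
  shows "sum f A \<in> K"
  using assms(2) by (induction A rule: infinite_finite_induct)
    (auto intro: type_ideal_0 type_ideal_add assms(1))

lemma type_ideal_UNIV: "type_ideal UNIV"
  by (simp add: type_ideal_iff)

text \<open>This is the colon ideal \<open>K : c\<close>. Checking generators against it replaces
  decompositions of elements of an ideal, or of a power of it, into sums of products.\<close>

lemma type_ideal_scale_vimage: "type_ideal K \<Longrightarrow> type_ideal {x. c * x \<in> K}"
  unfolding type_ideal_iff by (simp add: distrib_left mult.left_commute)

lemma type_ideal_genideal: "type_ideal (genideal ring_of_type_algebra G)"
  by (rule ring.genideal_ideal) (simp_all add: ring_from_type_algebra)

lemma genideal_superset: "G \<subseteq> genideal (ring_of_type_algebra :: 'a::comm_ring_1 ring) G"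
  by (rule ring.genideal_self) (simp_all add: ring_from_type_algebra)

lemma genideal_subset: "type_ideal K \<Longrightarrow> G \<subseteq> K \<Longrightarrow> genideal ring_of_type_algebra G \<subseteq> K"
  by (rule ring.genideal_minimal) (simp_all add: ring_from_type_algebra)

lemma primeideal_type_iff:
  fixes P :: "'a::comm_ring_1 set"
  shows "primeideal P ring_of_type_algebra \<longleftrightarrow>
    type_ideal P \<and> 1 \<notin> P \<and> (\<forall>x y. x * y \<in> P \<longrightarrow> x \<in> P \<or> y \<in> P)"
proof -
  have "type_ideal P \<Longrightarrow> 1 \<in> P \<longleftrightarrow> P = UNIV"
    using type_ideal_mult[of P 1] by auto
  then show ?thesis
    using cring_from_type_algebra
    by (auto simp: primeideal_def primeideal_axioms_def)
qed

section \<open>Powers of an ideal\<close>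

definition ideal_pow :: "'a::comm_ring_1 set \<Rightarrow> nat \<Rightarrow> 'a set" where
  "ideal_pow I n = I [^]\<^bsub>ideals_set ring_of_type_algebra\<^esub> n"

lemma ideal_pow_0: "ideal_pow I 0 = (UNIV :: 'a::comm_ring_1 set)"
  and ideal_pow_Suc: "ideal_pow I (Suc n) = ideal_prod ring_of_type_algebra (ideal_pow I n) I"
  by (simp_all add: ideal_pow_def nat_pow_def ideals_set_def)

lemma type_ideal_pow: "type_ideal I \<Longrightarrow> type_ideal (ideal_pow I n)"
  by (induction n) (simp_all add: ideal_pow_0 ideal_pow_Suc type_ideal_UNIV
      ring.ideal_prod_is_ideal[OF ring_from_type_algebra])

lemma ideal_pow_Suc_mult: "x \<in> ideal_pow I n \<Longrightarrow> y \<in> I \<Longrightarrow> x * y \<in> ideal_pow I (Suc n)"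
  using ideal_prod.prod[of x "ideal_pow I n" y I ring_of_type_algebra]
  by (simp only: ideal_pow_Suc rta_simps)

lemma ideal_pow_Suc_subset:
  assumes "type_ideal K" "\<And>x y. x \<in> ideal_pow I n \<Longrightarrow> y \<in> I \<Longrightarrow> x * y \<in> K"
  shows "ideal_pow I (Suc n) \<subseteq> K"
proof
  fix z assume "z \<in> ideal_pow I (Suc n)"
  then show "z \<in> K"
    unfolding ideal_pow_Suc
    by induction (use assms in \<open>auto intro: type_ideal_add\<close>)
qed

lemma ideal_pow_1: "type_ideal I \<Longrightarrow> ideal_pow I (Suc 0) = I"
  using ideal_pow_Suc_mult[of 1 I 0] ideal_pow_Suc_subset[of I I 0]
  by (auto simp: ideal_pow_0 type_ideal_mult)

lemma ideal_pow_add_mult: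
  assumes I: "type_ideal I" and x: "x \<in> ideal_pow I m" and y: "y \<in> ideal_pow I n"
  shows "x * y \<in> ideal_pow I (m + n)"
  using y
proof (induction n arbitrary: y)
  case 0
  then show ?case using x type_ideal_mult2[OF type_ideal_pow[OF I]] by simp
next
  case (Suc n)
  have "ideal_pow I (Suc n) \<subseteq> {y. x * y \<in> ideal_pow I (m + Suc n)}"
  proof (rule ideal_pow_Suc_subset)
    show "type_ideal {y. x * y \<in> ideal_pow I (m + Suc n)}"
      by (intro type_ideal_scale_vimage type_ideal_pow I)
    show "a * b \<in> {y. x * y \<in> ideal_pow I (m + Suc n)}" if "a \<in> ideal_pow I n" "b \<in> I" for a b
      using ideal_pow_Suc_mult[OF Suc.IH[OF that(1)] that(2)] by (simp add: mult.assoc)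
  qed
  then show ?case using Suc.prems by blast
qed

lemma ideal_pow_antimono:
  assumes "type_ideal I" "m \<le> n"
  shows "ideal_pow I n \<subseteq> ideal_pow I m"
proof -
  have "ideal_pow I (Suc k) \<subseteq> ideal_pow I k" for k
    by (rule ideal_pow_Suc_subset) (auto intro: type_ideal_pow type_ideal_mult2 assms(1))
  then show ?thesis using assms(2) by (rule lift_Suc_antimono_le)
qed

lemma ideal_pow_mono:
  assumes "type_ideal I" "J \<subseteq> I"
  shows "ideal_pow J n \<subseteq> ideal_pow I n"
proof (induction n)
  case (Suc n)
  show ?case
    unfolding ideal_pow_Suc[of J]
  proof
    fix z assume "z \<in> ideal_prod ring_of_type_algebra (ideal_pow J n) J"
    then show "z \<in> ideal_pow I (Suc n)"
      by induction
        (use Suc assms in \<open>auto intro: type_ideal_add type_ideal_pow ideal_pow_Suc_mult\<close>)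
  qed
qed (simp add: ideal_pow_0)

text \<open>In a product of \<open>n\<close> elements of \<open>I\<close>, each factor absorbs one
  copy of \<open>u\<close>. This transfers powers of \<open>I\<close> to powers of an ideal that
  agrees with \<open>I\<close> only after inverting \<open>u\<close>.\<close>

lemma ideal_pow_scale_subset:
  assumes J: "type_ideal J" and u: "\<And>x. x \<in> I \<Longrightarrow> u * x \<in> J" and x: "x \<in> ideal_pow I n"
  shows "u ^ n * x \<in> ideal_pow J n"
  using x
proof (induction n arbitrary: x)
  case (Suc n)
  have "ideal_pow I (Suc n) \<subseteq> {x. u ^ Suc n * x \<in> ideal_pow J (Suc n)}"
  proof (rule ideal_pow_Suc_subset)
    show "type_ideal {x. u ^ Suc n * x \<in> ideal_pow J (Suc n)}"
      by (intro type_ideal_scale_vimage type_ideal_pow J)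
    show "a * b \<in> {x. u ^ Suc n * x \<in> ideal_pow J (Suc n)}" if "a \<in> ideal_pow I n" "b \<in> I" for a b
      using ideal_pow_Suc_mult[OF Suc.IH[OF that(1)] u[OF that(2)]] by (simp add: mult_ac)
  qed
  then show ?case using Suc.prems by blast
qed (simp add: ideal_pow_0)

text \<open>Products of \<open>n\<close> generators generate the \<open>n\<close>-th power. One
  generator \<open>g\<close> is split off at a time by passing from \<open>K\<close> to
  \<open>K : g\<close>, so the induction must leave \<open>K\<close> arbitrary.\<close>

lemma ideal_pow_genideal_subset:
  assumes K: "type_ideal K"
    and G: "\<And>xs. set xs \<subseteq> G \<Longrightarrow> length xs = n \<Longrightarrow> prod_list xs \<in> K"
  shows "ideal_pow (genideal ring_of_type_algebra G) n \<subseteq> K"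
  using K G
proof (induction n arbitrary: K)
  case 0
  then have "1 \<in> K" using "0.prems"(2)[of "[]"] by simp
  then show ?case using type_ideal_mult[OF "0.prems"(1), of 1] by auto
next
  case (Suc n)
  show ?case
  proof (rule ideal_pow_Suc_subset[OF Suc.prems(1)])
    fix x y assume x: "x \<in> ideal_pow (genideal ring_of_type_algebra G) n"
      and y: "y \<in> genideal ring_of_type_algebra G"
    have "x * g \<in> K" if "g \<in> G" for g
    proof -
      have "ideal_pow (genideal ring_of_type_algebra G) n \<subseteq> {x. g * x \<in> K}"
      proof (rule Suc.IH)
        show "type_ideal {x. g * x \<in> K}" by (rule type_ideal_scale_vimage[OF Suc.prems(1)])
        show "prod_list xs \<in> {x. g * x \<in> K}" if "set xs \<subseteq> G" "length xs = n" for xs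
          using Suc.prems(2)[of "g # xs"] that \<open>g \<in> G\<close> by simp
      qed
      then show ?thesis using x by (auto simp: mult.commute)
    qed
    then have "genideal ring_of_type_algebra G \<subseteq> {y. x * y \<in> K}"
      by (intro genideal_subset type_ideal_scale_vimage Suc.prems(1)) auto
    then show "x * y \<in> K" using y by blast
  qed
qed

text \<open>
  Pigeonhole: a monomial of degree at least \<open>(n + 1) p + (h - 1) (p - 1)\<close> in \<open>h\<close> elements is
  divisible by the \<open>p\<close>-th power of a monomial of degree \<open>n + 1\<close>.
\<close>

lemma genideal_pow_subset_frobenius:
  fixes G :: "'a::comm_ring_1 set"
  assumes fin: "finite G" and p: "0 < p" and N: "n * p + 1 + card G * (p - 1) \<le> N"
    and K: "type_ideal K"
    and z: "\<And>z. z \<in> ideal_pow (genideal ring_of_type_algebra G) (n + 1) \<Longrightarrow> z ^ p \<in> K"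
  shows "ideal_pow (genideal ring_of_type_algebra G) N \<subseteq> K"
proof (rule ideal_pow_genideal_subset[OF K])
  fix xs :: "'a list" assume xs: "set xs \<subseteq> G" "length xs = N"
  let ?c = "\<lambda>g. count_list xs g" and ?J = "genideal ring_of_type_algebra G"
  have J: "type_ideal ?J" by (rule type_ideal_genideal)
  have prod: "prod_list xs = (\<Prod>g\<in>G. g ^ ?c g)"
    using xs(1)
  proof (induction xs)
    case (Cons a xs)
    have "(\<Prod>g\<in>G. g ^ count_list (a # xs) g) = (\<Prod>g\<in>G. (if g = a then a else 1) * g ^ count_list xs g)"
      by (rule prod.cong) auto
    also have "\<dots> = a * (\<Prod>g\<in>G. g ^ count_list xs g)"
      using Cons.prems fin by (simp add: prod.distrib)
    finally show ?case using Cons by simp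
  qed simp
  have sum: "(\<Sum>g\<in>G. ?c g) = N"
    using sum_count_set[OF xs(1) fin] xs(2) by simp
  \<comment> \<open>Each exponent is divided by \<open>p\<close> with remainder: \<open>z\<close>
    collects the quotients, and the remainders give the cofactor of \<open>z ^ p\<close> in the
    monomial.\<close>
  define z where "z = (\<Prod>g\<in>G. g ^ (?c g div p))"
  have "z \<in> ideal_pow ?J (\<Sum>g\<in>G. ?c g div p)"
  proof -
    have pw: "g ^ k \<in> ideal_pow ?J k" if "g \<in> G" for g k
    proof (induction k)
      case (Suc k)
      have "g \<in> ?J" using that genideal_superset by blast
      then show ?case using ideal_pow_Suc_mult[OF Suc] by (simp add: mult.commute)
    qed (simp add: ideal_pow_0)
    have "(\<Prod>g\<in>H. g ^ (?c g div p)) \<in> ideal_pow ?J (\<Sum>g\<in>H. ?c g div p)" if "H \<subseteq> G" for H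
      using finite_subset[OF that fin] that
    proof (induction H rule: finite_induct)
      case (insert g H)
      then show ?case using ideal_pow_add_mult[OF J pw] by simp
    qed (simp add: ideal_pow_0)
    then show ?thesis unfolding z_def by blast
  qed
  moreover have "n + 1 \<le> (\<Sum>g\<in>G. ?c g div p)"
  proof (rule ccontr)
    assume "\<not> ?thesis"
    then have "(\<Sum>g\<in>G. ?c g div p) \<le> n" by simp
    moreover have "N \<le> (\<Sum>g\<in>G. (?c g div p) * p + (p - 1))"
      unfolding sum[symmetric]
    proof (rule sum_mono)
      fix g
      have "?c g = (?c g div p) * p + ?c g mod p" by simp
      moreover have "?c g mod p < p" using p by simp
      ultimately show "?c g \<le> (?c g div p) * p + (p - 1)" by linarith
    qed
    then have "N \<le> (\<Sum>g\<in>G. ?c g div p) * p + card G * (p - 1)"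
      by (simp add: sum.distrib sum_distrib_right)
    moreover have "(\<Sum>g\<in>G. ?c g div p) * p \<le> n * p" using calculation(1) by simp
    ultimately show False using N by linarith
  qed
  ultimately have "z \<in> ideal_pow ?J (n + 1)"
    using ideal_pow_antimono[OF J] by blast
  then have "z ^ p \<in> K" by (rule z)
  moreover have "prod_list xs = z ^ p * (\<Prod>g\<in>G. g ^ (?c g mod p))"
    unfolding prod z_def
    by (simp add: prod_power_distrib prod.distrib[symmetric] power_mult[symmetric] power_add[symmetric])
  ultimately show "prod_list xs \<in> K"
    using type_ideal_mult2[OF K] by simp
qed

section \<open>Localized powers and symbolic powers\<close>

text \<open>The contraction to the ring of the extension of \<open>I^n\<close> to the localization
  at \<open>S\<close>, stated without fractions.\<close>

definition loc_pow :: "'a::idom set \<Rightarrow> 'a set \<Rightarrow> nat \<Rightarrow> 'a set" where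
  "loc_pow S I n = {x. \<exists>s\<in>S. s * x \<in> ideal_pow I n}"

lemma rta_fract_localization [simp]:
  "carrier (localization S) = {Fract a s | a s. s \<in> S}"
  "monoid.mult (localization S) = (*)" "one (localization S) = 1"
  "zero (localization S) = 0" "add (localization S) = (+)"
  by (auto simp: localization_def)

locale mult_closed =
  fixes S :: "'a::idom set"
  assumes one_in: "1 \<in> S" and zero_notin: "0 \<notin> S"
    and mult_in: "s \<in> S \<Longrightarrow> t \<in> S \<Longrightarrow> s * t \<in> S"
begin

lemma nonzero: "s \<in> S \<Longrightarrow> s \<noteq> 0"
  using zero_notin by blast

lemma power_in: "s \<in> S \<Longrightarrow> s ^ n \<in> S"
  by (induction n) (auto intro: one_in mult_in)

lemma ring_localization: "ring (localization S)"
proof -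
  have add: "Fract a s + Fract b t \<in> carrier (localization S)" if "s \<in> S" "t \<in> S" for a b s t
    using that mult_in nonzero by auto
  have mult: "Fract a s * Fract b t \<in> carrier (localization S)" if "s \<in> S" "t \<in> S" for a b s t
    using that mult_in by auto
  have zero: "0 \<in> carrier (localization S)" and one: "1 \<in> carrier (localization S)"
    using one_in by (auto simp: Zero_fract_def One_fract_def)
  have neg: "\<exists>y\<in>carrier (localization S). y + Fract a s = 0" if "s \<in> S" for a s
  proof
    show "Fract (- a) s + Fract a s = 0" using that nonzero by (simp add: eq_fract Zero_fract_def)
    show "Fract (- a) s \<in> carrier (localization S)" using that by auto
  qed
  show ?thesis
  proof (rule ringI)
    show "abelian_group (localization S)"
      by (rule abelian_groupI) (use add zero neg in \<open>auto simp: algebra_simps\<close>)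
    show "Group.monoid (localization S)"
      by (rule monoidI) (use mult one in \<open>auto simp: algebra_simps\<close>)
  qed (simp_all add: algebra_simps)
qed

text \<open>Two fractions have a common denominator in \<open>S\<close>, so the fractions with
  numerator in \<open>I\<close> are already closed under addition. Each of them is a multiple
  \<open>Fract 1 s * to_fract a\<close> of a generator.\<close>

lemma genideal_localization:
  assumes I: "type_ideal I"
  shows "genideal (localization S) (to_fract ` I) = {Fract a s | a s. a \<in> I \<and> s \<in> S}" (is "_ = ?K")
proof (rule equalityI)
  interpret ring "localization S" by (rule ring_localization)
  have neg: "inv\<^bsub>add_monoid (localization S)\<^esub> x = - x" if "x \<in> carrier (localization S)" for x
  proof -
    obtain a s where x: "x = Fract a s" "s \<in> S" using \<open>x \<in> carrier (localization S)\<close> by auto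
    then have "- x \<in> carrier (localization S)" by auto
    then have "\<ominus>\<^bsub>localization S\<^esub> x = - x" using that by (intro minus_equality) auto
    then show ?thesis by (simp add: a_inv_def)
  qed
  have "ideal ?K (localization S)"
  proof (rule idealI)
    show "ring (localization S)" by (rule ring_localization)
    show "subgroup ?K (add_monoid (localization S))"
      unfolding subgroup_def
    proof (intro conjI allI impI ballI)
      show "?K \<subseteq> carrier (add_monoid (localization S))" by auto
      show "\<one>\<^bsub>add_monoid (localization S)\<^esub> \<in> ?K"
        using type_ideal_0[OF I] one_in by (auto simp: Zero_fract_def)
      fix x assume "x \<in> ?K"
      then obtain a s where x: "x = Fract a s" "a \<in> I" "s \<in> S" by auto
      then have "inv\<^bsub>add_monoid (localization S)\<^esub> x = Fract (- a) s" by (subst neg) auto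
      then show "inv\<^bsub>add_monoid (localization S)\<^esub> x \<in> ?K"
        using type_ideal_uminus[OF I x(2)] x(3) by blast
      fix y assume "y \<in> ?K"
      then obtain b t where y: "y = Fract b t" "b \<in> I" "t \<in> S" by auto
      have "x + y = Fract (a * t + b * s) (s * t)"
        using x y nonzero by simp
      moreover have "a * t + b * s \<in> I"
        using x y by (auto intro: type_ideal_add type_ideal_mult2 I)
      ultimately show "x \<otimes>\<^bsub>add_monoid (localization S)\<^esub> y \<in> ?K"
        using mult_in x y by auto
    qed
    fix x y assume "x \<in> ?K" "y \<in> carrier (localization S)"
    then obtain a s b t where "x = Fract a s" "a \<in> I" "s \<in> S" "y = Fract b t" "t \<in> S" by auto
    moreover from this have "b * a \<in> I" "a * b \<in> I"
      by (auto intro: type_ideal_mult type_ideal_mult2 I)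
    ultimately show "y \<otimes>\<^bsub>localization S\<^esub> x \<in> ?K" "x \<otimes>\<^bsub>localization S\<^esub> y \<in> ?K"
      using mult_in by auto
  qed
  moreover have "to_fract ` I \<subseteq> ?K"
    using one_in by (auto simp: to_fract_def)
  ultimately show "genideal (localization S) (to_fract ` I) \<subseteq> ?K"
    by (rule genideal_minimal)
  show "?K \<subseteq> genideal (localization S) (to_fract ` I)"
  proof
    fix x assume "x \<in> ?K"
    then obtain a s where x: "x = Fract a s" "a \<in> I" "s \<in> S" by auto
    have sub: "to_fract ` I \<subseteq> carrier (localization S)"
      using one_in by (auto simp: to_fract_def)
    interpret J: ideal "genideal (localization S) (to_fract ` I)" "localization S"
      by (rule genideal_ideal[OF sub])
    have "to_fract a \<in> genideal (localization S) (to_fract ` I)"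
      using genideal_self[OF sub] x(2) by blast
    moreover have "Fract 1 s \<in> carrier (localization S)" using x(3) by auto
    ultimately have "Fract 1 s * to_fract a \<in> genideal (localization S) (to_fract ` I)"
      using J.I_l_closed by simp
    then show "x \<in> genideal (localization S) (to_fract ` I)"
      using x by (simp add: to_fract_def)
  qed
qed

lemma fract_mem_iff: 
  assumes I: "type_ideal I"
  shows "to_fract x \<in> genideal (localization S) (to_fract ` I) \<longleftrightarrow> (\<exists>s\<in>S. s * x \<in> I)"
proof -
  have "to_fract x = Fract a s \<longleftrightarrow> s * x = a" if "s \<in> S" for a s
    using nonzero[OF that] by (auto simp: to_fract_def eq_fract mult.commute)
  then show ?thesis
    unfolding genideal_localization[OF I] mem_Collect_eq by metis
qed

lemma loc_pow_mult:
  assumes I: "type_ideal I" and "x \<in> loc_pow S I m" "y \<in> loc_pow S I n"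
  shows "x * y \<in> loc_pow S I (m + n)"
proof -
  obtain s t where st: "s \<in> S" "s * x \<in> ideal_pow I m" "t \<in> S" "t * y \<in> ideal_pow I n"
    using assms by (auto simp: loc_pow_def)
  have "(s * t) * (x * y) \<in> ideal_pow I (m + n)"
    using ideal_pow_add_mult[OF I st(2,4)] by (simp add: mult_ac)
  then show ?thesis using mult_in st by (auto simp: loc_pow_def)
qed

lemma loc_pow_0: "loc_pow S I 0 = UNIV"
  using one_in by (auto simp: loc_pow_def ideal_pow_0)

lemma loc_pow_prod:
  assumes I: "type_ideal I" and "\<And>i. i \<in> A \<Longrightarrow> f i \<in> loc_pow S I (k i)"
  shows "prod f A \<in> loc_pow S I (sum k A)"
  using assms(2)
  by (induction A rule: infinite_finite_induct) (auto simp: loc_pow_0 intro: loc_pow_mult[OF I])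

lemma loc_pow_power:
  assumes I: "type_ideal I" and "x \<in> loc_pow S I k"
  shows "x ^ n \<in> loc_pow S I (n * k)"
  using loc_pow_prod[OF I, of "{..<n}" "\<lambda>_. x" "\<lambda>_. k"] assms(2) by simp

end

lemma symbolic_power_eq_loc_pow:
  assumes I: "type_ideal I" and "mult_closed S" and "\<Union>(minimal_primes I) = - S"
  shows "symbolic_power I n = loc_pow S I n"
proof -
  interpret mult_closed S by fact
  show ?thesis
    unfolding symbolic_power_def ideal_pow_def[symmetric]
    by (simp add: assms(3) fract_mem_iff[OF type_ideal_pow[OF I]] loc_pow_def)
qed

lemma mult_closed_compl_prime:
  assumes "primeideal P ring_of_type_algebra"
  shows "mult_closed (- P)"
  using assms unfolding primeideal_type_iff by unfold_locales (auto intro: type_ideal_0)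

section \<open>Evaluation of polynomials and the ideal of matrices of bounded rank\<close>

definition eval_monom :: "('v \<Rightarrow> 'b::comm_semiring_1) \<Rightarrow> ('v \<Rightarrow>\<^sub>0 nat) \<Rightarrow> 'b" where
  "eval_monom \<sigma> m = (\<Prod>v\<in>Poly_Mapping.keys m. \<sigma> v ^ Poly_Mapping.lookup m v)"

text \<open>The images of the coefficients and of the indeterminates are separate parameters because
  the targets vary: the field itself, another polynomial ring, and a fraction field.\<close>

definition peval :: "('k::field \<Rightarrow> 'b::comm_ring_1) \<Rightarrow> ('v \<Rightarrow> 'b) \<Rightarrow> (('v \<Rightarrow>\<^sub>0 nat) \<Rightarrow>\<^sub>0 'k) \<Rightarrow> 'b" where
  "peval c \<sigma> g = (\<Sum>m\<in>Poly_Mapping.keys g. c (Poly_Mapping.lookup g m) * eval_monom \<sigma> m)"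

lemma eval_monom_superset:
  assumes "finite A" "Poly_Mapping.keys m \<subseteq> A"
  shows "eval_monom \<sigma> m = (\<Prod>v\<in>A. \<sigma> v ^ Poly_Mapping.lookup m v)"
  unfolding eval_monom_def using assms
  by (intro prod.mono_neutral_left) (auto simp: in_keys_iff)

lemma eval_monom_0 [simp]: "eval_monom \<sigma> 0 = 1"
  by (simp add: eval_monom_def)

lemma eval_monom_add: "eval_monom \<sigma> (m + n) = eval_monom \<sigma> m * eval_monom \<sigma> n"
proof -
  have "Poly_Mapping.keys (m + n) \<subseteq> Poly_Mapping.keys m \<union> Poly_Mapping.keys n" by (rule keys_add)
  then show ?thesis
    by (simp add: eval_monom_superset[of "Poly_Mapping.keys m \<union> Poly_Mapping.keys n"] lookup_add power_add prod.distrib)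
qed

lemma poly_mapping_sum_single: "(\<Sum>m\<in>Poly_Mapping.keys g. Poly_Mapping.single m (Poly_Mapping.lookup g m)) = g"
  by (rule poly_mapping_eqI)
    (auto simp: lookup_sum lookup_single when_def in_keys_iff)

lemma single_0_hom: "comm_ring_hom (Poly_Mapping.single 0 :: 'k::comm_ring_1 \<Rightarrow> ('a::comm_monoid_add \<Rightarrow>\<^sub>0 'k))"
  by unfold_locales (simp_all add: single_add mult_single)

lemma to_fract_hom: "comm_ring_hom (to_fract :: 'a::idom \<Rightarrow> 'a fract)"
  by unfold_locales simp_all

lemma comm_ring_hom_comp: "comm_ring_hom f \<Longrightarrow> comm_ring_hom g \<Longrightarrow> comm_ring_hom (\<lambda>a. f (g a))"
proof -
  assume "comm_ring_hom f" "comm_ring_hom g"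
  then interpret f: comm_ring_hom f + g: comm_ring_hom g .
  show ?thesis by unfold_locales (simp_all add: f.hom_add g.hom_add f.hom_mult g.hom_mult)
qed

context comm_ring_hom
begin

lemma hom_eval_monom: "hom (eval_monom \<sigma> m) = eval_monom (\<lambda>v. hom (\<sigma> v)) m"
  by (simp add: eval_monom_def hom_distribs)

lemma hom_peval: "hom (peval c \<sigma> g) = peval (\<lambda>a. hom (c a)) (\<lambda>v. hom (\<sigma> v)) g"
  by (simp add: peval_def hom_distribs hom_eval_monom)

end

lemma peval_hom:
  assumes "comm_ring_hom c"
  shows "comm_ring_hom (peval c \<sigma>)"
proof -
  interpret comm_ring_hom c by fact
  have super: "peval c \<sigma> g = (\<Sum>m\<in>A. c (Poly_Mapping.lookup g m) * eval_monom \<sigma> m)"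
    if "finite A" "Poly_Mapping.keys g \<subseteq> A" for A g
    unfolding peval_def using that by (intro sum.mono_neutral_left) (auto simp: in_keys_iff)
  have add: "peval c \<sigma> (f + g) = peval c \<sigma> f + peval c \<sigma> g" for f g
    using keys_add[of f g]
    by (simp add: super[of "Poly_Mapping.keys f \<union> Poly_Mapping.keys g"] lookup_add hom_distribs distrib_right sum.distrib)
  have single: "peval c \<sigma> (Poly_Mapping.single m a) = c a * eval_monom \<sigma> m" for m a
    by (simp add: peval_def)
  have zero: "peval c \<sigma> 0 = 0" by (simp add: peval_def)
  have sum: "peval c \<sigma> (sum F A) = (\<Sum>i\<in>A. peval c \<sigma> (F i))" for A and F :: "_ \<Rightarrow> _"
    by (induction A rule: infinite_finite_induct) (simp_all add: add zero)
  have mult: "peval c \<sigma> (f * g) = peval c \<sigma> f * peval c \<sigma> g" for f g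
  proof -
    have "f * g = (\<Sum>m\<in>Poly_Mapping.keys f. \<Sum>n\<in>Poly_Mapping.keys g. Poly_Mapping.single (m + n) (Poly_Mapping.lookup f m * Poly_Mapping.lookup g n))"
      by (subst (1) poly_mapping_sum_single[of f, symmetric], subst (1) poly_mapping_sum_single[of g, symmetric])
        (simp only: sum_product mult_single)
    then have "peval c \<sigma> (f * g) = (\<Sum>m\<in>Poly_Mapping.keys f. \<Sum>n\<in>Poly_Mapping.keys g. 
        (c (Poly_Mapping.lookup f m) * eval_monom \<sigma> m) * (c (Poly_Mapping.lookup g n) * eval_monom \<sigma> n))"
      by (simp add: sum single eval_monom_add hom_mult mult_ac)
    then show ?thesis by (simp only: peval_def sum_product)
  qed
  have "peval c \<sigma> 1 = 1" by (simp add: peval_def lookup_one)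
  then show ?thesis by unfold_locales (simp_all add: add mult zero)
qed

lemma peval_indet:
  assumes "comm_ring_hom c"
  shows "peval c \<sigma> (indet v) = \<sigma> v"
proof -
  interpret comm_ring_hom c by fact
  show ?thesis by (simp add: peval_def indet_def eval_monom_def)
qed

lemma eval_monom_indet: "eval_monom indet m = Poly_Mapping.single m (1 :: 'k::field)"
proof -
  have pow: "indet v ^ n = Poly_Mapping.single (Poly_Mapping.single v n) (1 :: 'k)" for v :: 'a and n
    by (induction n) (simp_all add: indet_def mult_single single_add[symmetric] add.commute)
  have "(\<Prod>v\<in>A. indet v ^ Poly_Mapping.lookup m v)
      = Poly_Mapping.single (\<Sum>v\<in>A. Poly_Mapping.single v (Poly_Mapping.lookup m v)) (1 :: 'k)" for A
    by (induction A rule: infinite_finite_induct) (simp_all add: pow mult_single)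
  then show ?thesis by (simp add: eval_monom_def poly_mapping_sum_single)
qed

lemma peval_id: "peval (Poly_Mapping.single 0) indet g = g"
  unfolding peval_def by (simp add: eval_monom_indet mult_single poly_mapping_sum_single)

text \<open>Relational form of the uniqueness of evaluation. With \<open>R = same_residue P\<close>
  it replaces reduction to the residue field at \<open>P\<close>: evaluations that agree modulo
  \<open>P\<close> on coefficients and indeterminates agree modulo \<open>P\<close> on every
  polynomial.\<close>

lemma peval_rel:
  assumes add: "\<And>a b a' b'. R a b \<Longrightarrow> R a' b' \<Longrightarrow> R (a + a') (b + b')"
    and mult: "\<And>a b a' b'. R a b \<Longrightarrow> R a' b' \<Longrightarrow> R (a * a') (b * b')"
    and R0: "R 0 0" and R1: "R 1 1" and c: "\<And>a. R (c a) (c' a)" and \<sigma>: "\<And>v. R (\<sigma> v) (\<tau> v)"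
  shows "R (peval c \<sigma> g) (peval c' \<tau> g)"
proof -
  have pow: "R (\<sigma> v ^ n) (\<tau> v ^ n)" for v n
    by (induction n) (auto intro: R1 mult \<sigma>)
  have "R (\<Prod>v\<in>A. \<sigma> v ^ Poly_Mapping.lookup m v) (\<Prod>v\<in>A. \<tau> v ^ Poly_Mapping.lookup m v)" for A m
    by (induction A rule: infinite_finite_induct) (auto intro: R1 mult pow)
  then have mon: "R (eval_monom \<sigma> m) (eval_monom \<tau> m)" for m by (simp add: eval_monom_def)
  have "R (\<Sum>m\<in>A. c (Poly_Mapping.lookup g m) * eval_monom \<sigma> m) (\<Sum>m\<in>A. c' (Poly_Mapping.lookup g m) * eval_monom \<tau> m)" for A
    by (induction A rule: infinite_finite_induct) (auto intro: R0 add mult c mon)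
  then show ?thesis by (simp add: peval_def)
qed

text \<open>\<open>b\<close> lies in the localization at \<open>P\<close> and has the same residue as \<open>a\<close>.\<close>

definition same_residue :: "'a::idom set \<Rightarrow> 'a \<Rightarrow> 'a fract \<Rightarrow> bool" where
  "same_residue P a b \<longleftrightarrow> (\<exists>s d. s \<notin> P \<and> to_fract s * b = to_fract d \<and> s * a - d \<in> P)"

context
  fixes P :: "'a::idom set"
  assumes P: "primeideal P ring_of_type_algebra"
begin

lemma prime_ideal_facts: "type_ideal P" "1 \<notin> P" "s \<notin> P \<Longrightarrow> t \<notin> P \<Longrightarrow> s * t \<notin> P"
  using P by (auto simp: primeideal_type_iff)

lemma same_residue_to_fract: "same_residue P a (to_fract a)"
  unfolding same_residue_def
  by (rule exI[of _ 1], rule exI[of _ a]) (simp add: prime_ideal_facts(2) type_ideal_0[OF prime_ideal_facts(1)])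

lemma same_residue_add:
  assumes "same_residue P a b" "same_residue P a' b'"
  shows "same_residue P (a + a') (b + b')"
proof -
  obtain s d t e where 1: "s \<notin> P" "to_fract s * b = to_fract d" "s * a - d \<in> P"
    and 2: "t \<notin> P" "to_fract t * b' = to_fract e" "t * a' - e \<in> P"
    using assms unfolding same_residue_def by blast
  have "to_fract (s * t) * (b + b') = to_fract t * (to_fract s * b) + to_fract s * (to_fract t * b')"
    by (simp add: algebra_simps)
  also have "\<dots> = to_fract (t * d + s * e)" by (simp add: 1 2)
  finally have *: "to_fract (s * t) * (b + b') = to_fract (t * d + s * e)" .
  have "(s * t) * (a + a') - (t * d + s * e) = t * (s * a - d) + s * (t * a' - e)"
    by (simp add: algebra_simps)
  also have "\<dots> \<in> P"
    by (intro type_ideal_add type_ideal_mult prime_ideal_facts 1 2)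
  finally show ?thesis
    using * prime_ideal_facts(3)[OF 1(1) 2(1)] unfolding same_residue_def by blast
qed

lemma same_residue_mult:
  assumes "same_residue P a b" "same_residue P a' b'"
  shows "same_residue P (a * a') (b * b')"
proof -
  obtain s d t e where 1: "s \<notin> P" "to_fract s * b = to_fract d" "s * a - d \<in> P"
    and 2: "t \<notin> P" "to_fract t * b' = to_fract e" "t * a' - e \<in> P"
    using assms unfolding same_residue_def by blast
  have "to_fract (s * t) * (b * b') = (to_fract s * b) * (to_fract t * b')"
    by (simp add: algebra_simps)
  also have "\<dots> = to_fract (d * e)" by (simp add: 1 2)
  finally have *: "to_fract (s * t) * (b * b') = to_fract (d * e)" .
  have "(s * t) * (a * a') - d * e = (s * a) * (t * a' - e) + e * (s * a - d)"
    by (simp add: algebra_simps)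
  also have "\<dots> \<in> P"
    by (intro type_ideal_add type_ideal_mult prime_ideal_facts 1 2)
  finally show ?thesis
    using * prime_ideal_facts(3)[OF 1(1) 2(1)] unfolding same_residue_def by blast
qed

text \<open>Here \<open>d = 0\<close>, so \<open>s * a\<close> lies in \<open>P\<close> while
  \<open>s\<close> does not, and primality applies.\<close>

lemma same_residue_0D:
  assumes "same_residue P a 0"
  shows "a \<in> P"
proof -
  obtain s d where "s \<notin> P" "to_fract s * 0 = to_fract d" "s * a - d \<in> P"
    using assms unfolding same_residue_def by blast
  then show ?thesis using P by (auto simp: primeideal_type_iff)
qed

end

section \<open>The kernel of the generic matrix product\<close>

locale matrix_indices =
  fixes r s :: nat and x :: "nat \<Rightarrow> nat \<Rightarrow> 'v::linorder"
  assumes bij: "bij_betw (\<lambda>(i, j). x i j) ({..<r} \<times> {..<s}) UNIV"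
begin

definition coord :: "'v \<Rightarrow> nat \<times> nat" where
  "coord = inv_into ({..<r} \<times> {..<s}) (\<lambda>(i, j). x i j)"

abbreviation "row_of v \<equiv> fst (coord v)"
abbreviation "col_of v \<equiv> snd (coord v)"

lemma coord_x: "i < r \<Longrightarrow> j < s \<Longrightarrow> coord (x i j) = (i, j)"
  unfolding coord_def using inv_into_f_f[OF bij_betw_imp_inj_on[OF bij], of "(i, j)"] by simp

lemma x_coord: "x (row_of v) (col_of v) = v"
  and row_of_less: "row_of v < r" and col_of_less: "col_of v < s"
proof -
  have "v \<in> (\<lambda>(i, j). x i j) ` ({..<r} \<times> {..<s})"
    using bij_betw_imp_surj_on[OF bij] by blast
  then obtain i j where "v = x i j" "i < r" "j < s" by auto
  then show "x (row_of v) (col_of v) = v" "row_of v < r" "col_of v < s"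
    by (simp_all add: coord_x)
qed

text \<open>The indeterminates of \<open>K[Y, Z]\<close> are coded as natural numbers, a linearly
  ordered type, so that the target of \<open>factor_hom\<close> is a domain. \<open>Inl\<close> and
  \<open>Inr\<close> keep the two families disjoint.\<close>

definition left_var :: "nat \<Rightarrow> nat \<Rightarrow> nat" where
  "left_var i l = sum_encode (Inl (prod_encode (i, l)))"

definition right_var :: "nat \<Rightarrow> nat \<Rightarrow> nat" where
  "right_var l j = sum_encode (Inr (prod_encode (l, j)))"

definition factor_hom :: "nat \<Rightarrow> (('v \<Rightarrow>\<^sub>0 nat) \<Rightarrow>\<^sub>0 'k::field) \<Rightarrow> ((nat \<Rightarrow>\<^sub>0 nat) \<Rightarrow>\<^sub>0 'k)" where
  "factor_hom m = peval (Poly_Mapping.single 0)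
     (\<lambda>v. \<Sum>l<m. indet (left_var (row_of v) l) * indet (right_var l (col_of v)))"

text \<open>
  The kernel of the map from \<open>K[X]\<close> to the polynomial ring \<open>K[Y, Z]\<close> that sends \<open>X\<close> to the
  product \<open>Y Z\<close> of generic \<open>r \<times> m\<close> and \<open>m \<times> s\<close> matrices; it turns out to be the only
  minimal prime of the ideal of \<open>(m + 1)\<close>-minors.
\<close>

definition rank_ideal :: "nat \<Rightarrow> (('v \<Rightarrow>\<^sub>0 nat) \<Rightarrow>\<^sub>0 'k::field) set" where
  "rank_ideal m = {g. factor_hom m g = 0}"

lemma factor_hom_hom: "comm_ring_hom (factor_hom m)"
  unfolding factor_hom_def by (intro peval_hom single_0_hom)

text \<open>The kernel of a ring homomorphism into a domain is prime.\<close>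

lemma primeideal_rank_ideal: "primeideal (rank_ideal m) ring_of_type_algebra"
proof -
  interpret comm_ring_hom "factor_hom m" by (rule factor_hom_hom)
  show ?thesis
    unfolding primeideal_type_iff type_ideal_iff rank_ideal_def by (auto simp: hom_distribs)
qed

lemma factor_hom_x: 
  assumes "i < r" "j < s"
  shows "factor_hom m (indet (x i j)) = (\<Sum>l<m. indet (left_var i l) * indet (right_var l j))"
  by (simp add: factor_hom_def peval_indet[OF single_0_hom] coord_x assms)

text \<open>Any concrete product of matrices \<open>A\<close> and \<open>B\<close> is a specialization of the generic one.\<close>

lemma peval_rank_ideal:
  fixes c :: "'k::field \<Rightarrow> 'b::comm_ring_1"
  assumes c: "comm_ring_hom c" and g: "g \<in> rank_ideal m"
  shows "peval c (\<lambda>v. \<Sum>l<m. A (row_of v) l * B l (col_of v)) g = 0"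
proof -
  \<comment> \<open>The substitution of \<open>A\<close> for \<open>Y\<close> and \<open>B\<close>
    for \<open>Z\<close>, obtained by decoding the numbering of the indeterminates.\<close>
  define \<psi> where "\<psi> n = (case sum_decode n of
      Inl q \<Rightarrow> (case prod_decode q of (i, l) \<Rightarrow> A i l)
    | Inr q \<Rightarrow> (case prod_decode q of (l, j) \<Rightarrow> B l j))" for n
  interpret c: comm_ring_hom c by fact
  interpret \<psi>: comm_ring_hom "peval c \<psi>" by (rule peval_hom[OF c])
  have "peval c \<psi> (Poly_Mapping.single 0 a) = c a" for a
    by (simp add: peval_def)
  moreover have "peval c \<psi> (\<Sum>l<m. indet (left_var i l) * indet (right_var l j)) = (\<Sum>l<m. A i l * B l j)"
    for i j
    by (simp add: \<psi>.hom_sum \<psi>.hom_mult peval_indet[OF c] \<psi>_def left_var_def right_var_def)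
  ultimately have "peval c \<psi> (factor_hom m g) = peval c (\<lambda>v. \<Sum>l<m. A (row_of v) l * B l (col_of v)) g"
    unfolding factor_hom_def \<psi>.hom_peval by simp
  then show ?thesis using g by (simp add: rank_ideal_def)
qed

text \<open>Modulo \<open>P\<close> the matrix \<open>X\<close> equals \<open>(A / D) B\<close> with
  inner dimension at most \<open>m\<close>. Evaluation at this product kills
  \<open>rank_ideal m\<close>, and its value on \<open>g\<close> has the same residue as
  \<open>g\<close>.\<close>

lemma rank_ideal_subset_prime:
  fixes P :: "(('v \<Rightarrow>\<^sub>0 nat) \<Rightarrow>\<^sub>0 'k::field) set"
  assumes P: "primeideal P ring_of_type_algebra" and D: "D \<notin> P" and k: "k \<le> m"
    and AB: "\<And>i j. i < r \<Longrightarrow> j < s \<Longrightarrow> D * indet (x i j) - (\<Sum>l<k. A i l * B l j) \<in> P"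
  shows "rank_ideal m \<subseteq> P"
proof
  fix g :: "('v \<Rightarrow>\<^sub>0 nat) \<Rightarrow>\<^sub>0 'k" assume g: "g \<in> rank_ideal m"
  \<comment> \<open>The division by \<open>D\<close> takes place in the fraction field; columns
    \<open>k\<close> to \<open>m - 1\<close> are padded with zeros to reach inner dimension exactly
    \<open>m\<close>.\<close>
  define A' where "A' i l = (if l < k then to_fract (A i l) / to_fract D else 0)" for i l
  let ?c = "\<lambda>a. to_fract (Poly_Mapping.single 0 a)"
  let ?\<tau> = "\<lambda>v. \<Sum>l<m. A' (row_of v) l * to_fract (B l (col_of v))"
  have D0: "to_fract D \<noteq> 0" using D type_ideal_0[OF prime_ideal_facts(1)[OF P]] by auto
  have "same_residue P (indet v) (?\<tau> v)" for v
  proof -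
    have "?\<tau> v = (\<Sum>l<k. A' (row_of v) l * to_fract (B l (col_of v)))"
      using k by (intro sum.mono_neutral_right) (auto simp: A'_def)
    also have "to_fract D * \<dots> = (\<Sum>l<k. to_fract (A (row_of v) l * B l (col_of v)))"
      unfolding sum_distrib_left by (rule sum.cong) (use D0 in \<open>auto simp: A'_def\<close>)
    also have "\<dots> = to_fract (\<Sum>l<k. A (row_of v) l * B l (col_of v))"
      by (simp only: to_fract_sum)
    finally show ?thesis
      using AB[OF row_of_less[of v] col_of_less[of v]] D
      unfolding same_residue_def x_coord by blast
  qed
  then have "same_residue P (peval (Poly_Mapping.single 0) indet g) (peval ?c ?\<tau> g)"
    by (intro peval_rel[where R = "same_residue P"] same_residue_add same_residue_mult
        same_residue_to_fract P)
      (use same_residue_to_fract[OF P, of 0] same_residue_to_fract[OF P, of 1] in simp_all)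
  moreover have "peval ?c ?\<tau> g = 0"
    by (rule peval_rank_ideal[OF comm_ring_hom_comp[OF to_fract_hom single_0_hom] g,
          of A' "\<lambda>l j. to_fract (B l j)"])
  ultimately show "g \<in> P" by (simp add: peval_id same_residue_0D[OF P])
qed

end

section \<open>Minors and bordered minors\<close>

lemma ideal_pow_prod:
  assumes "finite T" "\<And>i. i \<in> T \<Longrightarrow> f i \<in> J"
  shows "prod f T \<in> ideal_pow J (card T)"
  using assms
proof (induction T rule: finite_induct)
  case (insert i T)
  then show ?case using ideal_pow_Suc_mult[of "prod f T" J "card T" "f i"] by (simp add: mult.commute)
qed (simp add: ideal_pow_0)

text \<open>
  \<open>det (A B + Y)\<close> is the determinant of the block matrix with rows \<open>(1, B)\<close> and \<open>(-A, Y)\<close>; every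
  Leibniz term of the latter uses at most \<open>k\<close> entries of \<open>-A\<close>, hence at least \<open>a - k\<close> entries
  of \<open>Y\<close>.
\<close>

lemma det_rank_perturbation_in_ideal_pow:
  fixes A B Y :: "'a::idom mat"
  assumes A: "A \<in> carrier_mat a k" and B: "B \<in> carrier_mat k a" and Y: "Y \<in> carrier_mat a a"
    and J: "type_ideal J" and YJ: "\<And>i j. i < a \<Longrightarrow> j < a \<Longrightarrow> Y $$ (i, j) \<in> J"
  shows "det (A * B + Y) \<in> ideal_pow J (a - k)"
proof -
  let ?M = "four_block_mat (1\<^sub>m k) B (- A) Y"
  \<comment> \<open>Right multiplication by this unipotent matrix clears the block \<open>B\<close>
    of \<open>?M\<close> and leaves \<open>A * B + Y\<close> in the lower right corner.\<close>
  let ?N = "four_block_mat (1\<^sub>m k) (- B) (0\<^sub>m a k) (1\<^sub>m a)"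
  have M: "?M \<in> carrier_mat (k + a) (k + a)" and N: "?N \<in> carrier_mat (k + a) (k + a)"
    using Y by auto
  have "?M * ?N = four_block_mat (1\<^sub>m k * 1\<^sub>m k + B * 0\<^sub>m a k) (1\<^sub>m k * - B + B * 1\<^sub>m a)
      (- A * 1\<^sub>m k + Y * 0\<^sub>m a k) (- A * - B + Y * 1\<^sub>m a)"
    by (rule mult_four_block_mat) (use A B Y in auto)
  also have "1\<^sub>m k * 1\<^sub>m k + B * 0\<^sub>m a k = 1\<^sub>m k" using B by simp
  also have "1\<^sub>m k * - B + B * 1\<^sub>m a = 0\<^sub>m k a"
    using B by (simp add: uminus_l_inv_mat)
  also have "- A * 1\<^sub>m k + Y * 0\<^sub>m a k = - A" using A Y by simp
  also have "- A * - B + Y * 1\<^sub>m a = A * B + Y" using A B Y by auto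
  finally have "det (?M * ?N) = det (1\<^sub>m k) * det (A * B + Y)"
    using A B Y by (simp add: det_four_block_mat_upper_right_zero[of _ k _ a])
  moreover have "det ?N = 1"
    using B by (subst det_four_block_mat_lower_left_zero[of _ k _ a]) auto
  ultimately have "det (A * B + Y) = det ?M"
    using det_mult[OF M N] by simp
  also have "det ?M = (\<Sum>\<pi> | \<pi> permutes {0..<k + a}. signof \<pi> * (\<Prod>i = 0..<k + a. ?M $$ (i, \<pi> i)))"
    by (rule det_def'[OF M])
  also have "\<dots> \<in> ideal_pow J (a - k)"
  proof (intro type_ideal_sum type_ideal_mult type_ideal_pow J)
    fix \<pi> assume "\<pi> \<in> {\<pi>. \<pi> permutes {0..<k + a}}"
    then have \<pi>: "\<pi> permutes {0..<k + a}" by simp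
    define T where "T = {i \<in> {k..<k + a}. k \<le> \<pi> i}"
    \<comment> \<open>Rows of the lower half whose factor comes from the block \<open>-A\<close>.
      They are mapped injectively to the first \<open>k\<close> columns; the remaining lower rows,
      collected in \<open>T\<close>, contribute entries of \<open>Y\<close>.\<close>
    define U where "U = {i \<in> {k..<k + a}. \<pi> i < k}"
    have "card U \<le> card {..<k}"
      using permutes_inj_on[OF \<pi>] by (intro card_inj_on_le[of \<pi>]) (auto simp: U_def)
    moreover have "card T + card U = a"
    proof -
      have "card (T \<union> U) = card T + card U"
        by (rule card_Un_disjoint) (auto simp: T_def U_def)
      moreover have "T \<union> U = {k..<k + a}" by (auto simp: T_def U_def)
      ultimately show ?thesis by simp
    qed
    ultimately have card: "a - k \<le> card T" by simp
    have "?M $$ (i, \<pi> i) \<in> J" if "i \<in> T" for i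
    proof -
      have "\<pi> i < k + a" using permutes_in_image[OF \<pi>, of i] that by (auto simp: T_def)
      then show ?thesis using that A B Y YJ by (auto simp: T_def)
    qed
    then have "(\<Prod>i\<in>T. ?M $$ (i, \<pi> i)) \<in> ideal_pow J (card T)"
      by (intro ideal_pow_prod) (auto simp: T_def)
    then have T: "(\<Prod>i\<in>T. ?M $$ (i, \<pi> i)) \<in> ideal_pow J (a - k)"
      using ideal_pow_antimono[OF J card] by blast
    have "(\<Prod>i = 0..<k + a. ?M $$ (i, \<pi> i)) 
        = (\<Prod>i\<in>{0..<k + a} - T. ?M $$ (i, \<pi> i)) * (\<Prod>i\<in>T. ?M $$ (i, \<pi> i))"
      by (rule prod.subset_diff) (auto simp: T_def)
    then show "(\<Prod>i = 0..<k + a. ?M $$ (i, \<pi> i)) \<in> ideal_pow J (a - k)"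
      by (simp only: type_ideal_mult[OF type_ideal_pow[OF J] T])
  qed
  finally show ?thesis .
qed

text \<open>Rows and columns are selected by arbitrary functions, with repetitions and in any order,
  so that bordering a minor by one more index never requires sorting.\<close>

definition gen_minor :: "(nat \<Rightarrow> nat \<Rightarrow> 'a::comm_ring_1) \<Rightarrow> nat \<Rightarrow> (nat \<Rightarrow> nat) \<Rightarrow> (nat \<Rightarrow> nat) \<Rightarrow> 'a" where
  "gen_minor f k \<rho> \<gamma> = det (mat k k (\<lambda>(a, b). f (\<rho> a) (\<gamma> b)))"

lemma gen_minor_0: "gen_minor f 0 \<rho> \<gamma> = 1"
  by (simp add: gen_minor_def det_dim_zero)

lemma gen_minor_transpose: "gen_minor f k \<rho> \<gamma> = gen_minor (\<lambda>i j. f j i) k \<gamma> \<rho>"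
proof -
  have "transpose_mat (mat k k (\<lambda>(a, b). f (\<rho> a) (\<gamma> b))) = mat k k (\<lambda>(a, b). f (\<rho> b) (\<gamma> a))"
    by (rule eq_matI) auto
  then show ?thesis
    unfolding gen_minor_def
    using det_transpose[of "mat k k (\<lambda>(a, b). f (\<rho> a) (\<gamma> b))" k] by simp
qed

lemma gen_minor_not_inj:
  assumes "\<not> inj_on \<rho> {..<k}"
  shows "gen_minor f k \<rho> \<gamma> = 0"
proof -
  obtain i j where "i < k" "j < k" "i \<noteq> j" "\<rho> i = \<rho> j" using assms by (auto simp: inj_on_def)
  then show ?thesis
    unfolding gen_minor_def
    by (intro det_identical_rows[of _ k i j]) (auto intro!: eq_vecI)
qed

text \<open>The factor \<open>u\<close> is the sign of the permutation that sorts the rows.\<close>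

lemma gen_minor_sort_rows:
  assumes inj: "inj_on \<rho> {..<k}"
  shows "\<exists>u. gen_minor f k \<rho> \<gamma> = u * gen_minor f k (pick (\<rho> ` {..<k})) \<gamma>"
proof -
  let ?I = "\<rho> ` {..<k}"
  have card: "card ?I = k" using card_image[OF inj] by simp
  have pick: "pick ?I b \<in> ?I" if "b < k" for b
    using pick_in_set_le[of b ?I] that card by simp
  \<comment> \<open>The position at which \<open>\<rho>\<close> takes its \<open>b\<close>-th
    smallest value; it is the identity from \<open>k\<close> on, as \<open>permutes\<close>
    requires.\<close>
  define \<pi> where "\<pi> b = (if b < k then inv_into {..<k} \<rho> (pick ?I b) else b)" for b
  have \<rho>\<pi>: "\<rho> (\<pi> b) = pick ?I b" "\<pi> b < k" if "b < k" for b
    using f_inv_into_f[OF pick[OF that]] inv_into_into[OF pick[OF that]] that by (simp_all add: \<pi>_def)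
  have "inj_on (pick ?I) {..<k}"
    by (rule linorder_inj_onI) (use pick_mono_le[of _ ?I] card in \<open>force+\<close>)
  then have "inj_on \<pi> {..<k}"
    unfolding inj_on_def by (metis \<rho>\<pi>(1) lessThan_iff)
  then have "bij_betw \<pi> {..<k} {..<k}"
    using \<rho>\<pi>(2) by (intro bij_betw_imageI endo_inj_surj) auto
  then have \<pi>: "\<pi> permutes {0..<k}"
    by (intro bij_imp_permutes) (auto simp: \<pi>_def atLeast0LessThan)
  have "mat k k (\<lambda>(i, j). mat k k (\<lambda>(a, b). f (\<rho> a) (\<gamma> b)) $$ (\<pi> i, j))
      = mat k k (\<lambda>(a, b). f (pick ?I a) (\<gamma> b))"
    by (rule cong_mat) (auto simp: \<rho>\<pi>)
  then have "gen_minor f k (pick ?I) \<gamma> = signof \<pi> * gen_minor f k \<rho> \<gamma>"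
    using det_permute_rows[OF _ \<pi>, of "mat k k (\<lambda>(a, b). f (\<rho> a) (\<gamma> b))"]
    unfolding gen_minor_def by simp
  then have "gen_minor f k \<rho> \<gamma> = signof \<pi> * gen_minor f k (pick ?I) \<gamma>"
    by (cases \<pi> rule: sign_cases) auto
  then show ?thesis by blast
qed

lemma det_submatrix_eq_gen_minor:
  assumes "I \<subseteq> {..<r}" "J \<subseteq> {..<s}" "card I = k" "card J = k"
  shows "det (submatrix (mat r s (\<lambda>(i, j). f i j)) I J) = gen_minor f k (pick I) (pick J)"
    and "pick I ` {..<k} \<subseteq> {..<r}" "pick J ` {..<k} \<subseteq> {..<s}"
proof -
  have pick: "pick I a < r" "pick J a < s" if "a < k" for a
    using pick_in_set_le[of a I] pick_in_set_le[of a J] that assms by auto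
  then show "pick I ` {..<k} \<subseteq> {..<r}" "pick J ` {..<k} \<subseteq> {..<s}" by auto
  have "{i. i < r \<and> i \<in> I} = I" "{j. j < s \<and> j \<in> J} = J" using assms by auto
  then have "submatrix (mat r s (\<lambda>(i, j). f i j)) I J = mat k k (\<lambda>(a, b). f (pick I a) (pick J b))"
    unfolding submatrix_def by (intro eq_matI) (simp_all add: assms pick)
  then show "det (submatrix (mat r s (\<lambda>(i, j). f i j)) I J) = gen_minor f k (pick I) (pick J)"
    by (simp add: gen_minor_def)
qed

lemma minorsE:
  assumes "y \<in> minors k (mat r s (\<lambda>(i, j). f i j))"
  obtains \<rho> \<gamma> where "y = gen_minor f k \<rho> \<gamma>" "\<rho> ` {..<k} \<subseteq> {..<r}" "\<gamma> ` {..<k} \<subseteq> {..<s}"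
proof -
  obtain I J where y: "y = det (submatrix (mat r s (\<lambda>(i, j). f i j)) I J)"
    and IJ: "I \<subseteq> {..<r}" "J \<subseteq> {..<s}" "card I = k" "card J = k"
    using assms unfolding minors_def by auto
  show ?thesis
    by (rule that[OF _ det_submatrix_eq_gen_minor(2,3)[OF IJ]])
      (simp only: y det_submatrix_eq_gen_minor(1)[OF IJ])
qed

text \<open>A repeated row or column makes the determinant vanish; otherwise sorting both index
  lists yields, up to sign, a member of \<open>minors\<close>.\<close>

lemma gen_minor_in_ideal:
  assumes K: "type_ideal K" and minors: "minors k (mat r s (\<lambda>(i, j). f i j)) \<subseteq> K"
    and \<rho>: "\<rho> ` {..<k} \<subseteq> {..<r}" and \<gamma>: "\<gamma> ` {..<k} \<subseteq> {..<s}"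
  shows "gen_minor f k \<rho> \<gamma> \<in> K"
proof (cases "inj_on \<rho> {..<k} \<and> inj_on \<gamma> {..<k}")
  case False
  then have "gen_minor f k \<rho> \<gamma> = 0"
    using gen_minor_not_inj[of \<rho> k f \<gamma>] gen_minor_not_inj[of \<gamma> k "\<lambda>i j. f j i" \<rho>]
    by (auto simp: gen_minor_transpose[of f])
  then show ?thesis using type_ideal_0[OF K] by simp
next
  case True
  let ?I = "\<rho> ` {..<k}" and ?J = "\<gamma> ` {..<k}"
  obtain u where u: "gen_minor f k \<rho> \<gamma> = u * gen_minor f k (pick ?I) \<gamma>"
    using gen_minor_sort_rows[of \<rho> k f \<gamma>] True by blast
  obtain v where v: "gen_minor f k (pick ?I) \<gamma> = v * gen_minor f k (pick ?I) (pick ?J)"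
    using gen_minor_sort_rows[of \<gamma> k "\<lambda>i j. f j i" "pick ?I"] True
    by (auto simp: gen_minor_transpose[of f])
  have card: "card ?I = k" "card ?J = k"
    using True by (simp_all add: card_image)
  have "det (submatrix (mat r s (\<lambda>(i, j). f i j)) ?I ?J) \<in> minors k (mat r s (\<lambda>(i, j). f i j))"
    unfolding minors_def using \<rho> \<gamma> card by auto
  then have "gen_minor f k (pick ?I) (pick ?J) \<in> K"
    using minors by (auto simp: det_submatrix_eq_gen_minor(1)[OF \<rho> \<gamma> card])
  then show ?thesis unfolding u v by (intro type_ideal_mult K)
qed

definition extend_index :: "nat \<Rightarrow> (nat \<Rightarrow> nat) \<Rightarrow> nat \<Rightarrow> nat \<Rightarrow> nat" where
  "extend_index k \<rho> i a = (if a < k then \<rho> a else i)"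

text \<open>
  If \<open>W\<close> is the chosen \<open>k \<times> k\<close> submatrix with determinant \<open>\<Delta>\<close>, \<open>U\<close> the part of column \<open>j\<close> in its rows and
  \<open>V\<close> the part of row \<open>i\<close> in its columns, then \<open>\<Delta> f\<^sub>i\<^sub>j = V adj(W) U + G\<close> with \<open>G\<close> the bordered minor.
\<close>

lemma bordered_minor:
  fixes f :: "nat \<Rightarrow> nat \<Rightarrow> 'a::idom"
  assumes nz: "gen_minor f k \<rho> \<gamma> \<noteq> 0"
  shows "gen_minor f k \<rho> \<gamma> * f i j =
    (\<Sum>l<k. (\<Sum>q<k. f i (\<gamma> q) * adj_mat (mat k k (\<lambda>(a, b). f (\<rho> a) (\<gamma> b))) $$ (q, l)) * f (\<rho> l) j)
    + gen_minor f (Suc k) (extend_index k \<rho> i) (extend_index k \<gamma> j)"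
proof -
  let ?W = "mat k k (\<lambda>(a, b). f (\<rho> a) (\<gamma> b))"
  let ?U = "mat k 1 (\<lambda>(a, b). f (\<rho> a) j)" and ?V = "mat 1 k (\<lambda>(a, b). f i (\<gamma> b))"
  let ?z = "mat 1 1 (\<lambda>_. f i j)" and ?\<Delta> = "det ?W"
  let ?adj = "adj_mat ?W"
  have W: "?W \<in> carrier_mat k k" by simp
  note adj = adj_mat[OF W]
  let ?M = "four_block_mat ?W ?U ?V ?z"
  \<comment> \<open>The left block column turns \<open>?W\<close> into \<open>?\<Delta>\<close>
    times the identity; the right one eliminates \<open>?U\<close>. The product is block lower
    triangular, with corner entry \<open>?\<Delta> * f i j\<close> minus the correction by the
    adjugate.\<close>
  let ?N = "four_block_mat ?adj (- (?adj * ?U)) (0\<^sub>m 1 k) (?\<Delta> \<cdot>\<^sub>m 1\<^sub>m 1)"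
  have M: "?M \<in> carrier_mat (k + 1) (k + 1)" and N: "?N \<in> carrier_mat (k + 1) (k + 1)"
    using adj(1) by auto
  have "?M * ?N = four_block_mat (?W * ?adj + ?U * 0\<^sub>m 1 k) (?W * - (?adj * ?U) + ?U * (?\<Delta> \<cdot>\<^sub>m 1\<^sub>m 1))
      (?V * ?adj + ?z * 0\<^sub>m 1 k) (?V * - (?adj * ?U) + ?z * (?\<Delta> \<cdot>\<^sub>m 1\<^sub>m 1))"
    by (rule mult_four_block_mat) (use adj(1) in auto)
  also have "?W * ?adj + ?U * 0\<^sub>m 1 k = ?\<Delta> \<cdot>\<^sub>m 1\<^sub>m k" using adj(1,2) by simp
  also have "?W * - (?adj * ?U) + ?U * (?\<Delta> \<cdot>\<^sub>m 1\<^sub>m 1) = 0\<^sub>m k 1"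
  proof -
    have "?W * (?adj * ?U) = ?\<Delta> \<cdot>\<^sub>m ?U"
      using assoc_mult_mat[OF W adj(1), of ?U 1] adj(2)
        mult_smult_assoc_mat[of "1\<^sub>m k" k k ?U 1 ?\<Delta>] by simp
    then have "?W * - (?adj * ?U) = - (?\<Delta> \<cdot>\<^sub>m ?U)" using adj(1) by auto
    moreover have "?U * (?\<Delta> \<cdot>\<^sub>m 1\<^sub>m 1) = ?\<Delta> \<cdot>\<^sub>m ?U" using mult_smult_distrib[of ?U k 1 "1\<^sub>m 1" 1 ?\<Delta>] by simp
    ultimately show ?thesis by (simp add: uminus_l_inv_mat)
  qed
  finally have MN: "?M * ?N = four_block_mat (?\<Delta> \<cdot>\<^sub>m 1\<^sub>m k) (0\<^sub>m k 1)
      (?V * ?adj + ?z * 0\<^sub>m 1 k) (?V * - (?adj * ?U) + ?z * (?\<Delta> \<cdot>\<^sub>m 1\<^sub>m 1))" .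
  have "det (?M * ?N) = det (?\<Delta> \<cdot>\<^sub>m 1\<^sub>m k) * det (?V * - (?adj * ?U) + ?z * (?\<Delta> \<cdot>\<^sub>m 1\<^sub>m 1))"
    unfolding MN by (rule det_four_block_mat_upper_right_zero) (use adj(1) in auto)
  also have "det (?\<Delta> \<cdot>\<^sub>m 1\<^sub>m k) = ?\<Delta> ^ k" by simp
  also have "det (?V * - (?adj * ?U) + ?z * (?\<Delta> \<cdot>\<^sub>m 1\<^sub>m 1))
      = ?\<Delta> * f i j - (?V * (?adj * ?U)) $$ (0, 0)"
  proof -
    have "?V * - (?adj * ?U) + ?z * (?\<Delta> \<cdot>\<^sub>m 1\<^sub>m 1) \<in> carrier_mat 1 1" using adj(1) by auto
    then show ?thesis
      using adj(1) by (subst det_single) (auto simp: scalar_prod_def)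
  qed
  finally have 1: "det ?M * det ?N = ?\<Delta> ^ k * (?\<Delta> * f i j - (?V * (?adj * ?U)) $$ (0, 0))"
    using det_mult[OF M N] by simp
  have "det ?N = det ?adj * ?\<Delta>"
    using adj(1) by (subst det_four_block_mat_lower_left_zero[of _ k _ 1]) (auto simp: det_single[of "?\<Delta> \<cdot>\<^sub>m 1\<^sub>m 1"])
  also have "\<dots> = det (?adj * ?W)" using det_mult[OF adj(1) W] by simp
  also have "\<dots> = ?\<Delta> ^ k" by (simp add: adj(3))
  finally have "?\<Delta> ^ k * det ?M = ?\<Delta> ^ k * (?\<Delta> * f i j - (?V * (?adj * ?U)) $$ (0, 0))"
    using 1 by (simp only: mult.commute)
  \<comment> \<open>Both \<open>det ?N\<close> and the upper left block of the product contribute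
    the factor \<open>?\<Delta> ^ k\<close>; \<open>nz\<close> allows it to be cancelled in the
    domain.\<close>
  moreover have "?\<Delta> ^ k \<noteq> 0" using nz by (simp add: gen_minor_def)
  ultimately have "det ?M = ?\<Delta> * f i j - (?V * (?adj * ?U)) $$ (0, 0)"
    using mult_left_cancel[of "?\<Delta> ^ k"] by blast
  then have 2: "?\<Delta> * f i j = (?V * (?adj * ?U)) $$ (0, 0) + det ?M"
    by (metis add.commute diff_add_cancel)
  have "?M = mat (Suc k) (Suc k) (\<lambda>(a, b). f (extend_index k \<rho> i a) (extend_index k \<gamma> j b))"
    by (rule eq_matI) (auto simp: extend_index_def)
  then have 3: "det ?M = gen_minor f (Suc k) (extend_index k \<rho> i) (extend_index k \<gamma> j)"
    by (simp add: gen_minor_def)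
  have "?V * (?adj * ?U) = (?V * ?adj) * ?U"
    using assoc_mult_mat[of ?V 1 k ?adj k ?U 1] adj(1) by simp
  then have "(?V * (?adj * ?U)) $$ (0, 0) = (\<Sum>l<k. (\<Sum>q<k. f i (\<gamma> q) * ?adj $$ (q, l)) * f (\<rho> l) j)"
    using adj(1) by (auto simp: scalar_prod_def atLeast0LessThan intro!: sum.cong)
  then show ?thesis using 2 3 by (simp add: gen_minor_def)
qed

lemma (in comm_ring_hom) hom_gen_minor:
  "hom (gen_minor f k \<rho> \<gamma>) = gen_minor (\<lambda>i j. hom (f i j)) k \<rho> \<gamma>"
proof -
  have "map_mat hom (mat k k (\<lambda>(a, b). f (\<rho> a) (\<gamma> b))) = mat k k (\<lambda>(a, b). hom (f (\<rho> a) (\<gamma> b)))"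
    by (rule eq_matI) auto
  then show ?thesis unfolding gen_minor_def hom_det[symmetric] by simp
qed

text \<open>Each of the \<open>n\<close> rows absorbs one factor \<open>u\<close>, and the scaled
  matrix is a product of inner dimension \<open>k\<close> plus a matrix over \<open>J\<close>. The
  lemma is applied with \<open>J\<close> zero, determinantal, and generated by the bordered
  minors.\<close>

lemma gen_minor_in_ideal_pow:
  fixes f :: "nat \<Rightarrow> nat \<Rightarrow> 'a::idom"
  assumes J: "type_ideal J"
    and Y: "\<And>a b. a < n \<Longrightarrow> b < n \<Longrightarrow> u * f (\<rho> a) (\<gamma> b) - (\<Sum>l<k. A (\<rho> a) l * B l (\<gamma> b)) \<in> J"
  shows "u ^ n * gen_minor f n \<rho> \<gamma> \<in> ideal_pow J (n - k)"
proof -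
  let ?A = "mat n k (\<lambda>(a, l). A (\<rho> a) l)" and ?B = "mat k n (\<lambda>(l, b). B l (\<gamma> b))"
  let ?Y = "mat n n (\<lambda>(a, b). u * f (\<rho> a) (\<gamma> b) - (\<Sum>l<k. A (\<rho> a) l * B l (\<gamma> b)))"
  have "?A * ?B + ?Y = u \<cdot>\<^sub>m mat n n (\<lambda>(a, b). f (\<rho> a) (\<gamma> b))"
    by (rule eq_matI) (auto simp: scalar_prod_def atLeast0LessThan)
  then have "u ^ n * gen_minor f n \<rho> \<gamma> = det (?A * ?B + ?Y)"
    by (simp add: gen_minor_def)
  also have "\<dots> \<in> ideal_pow J (n - k)"
    using Y by (intro det_rank_perturbation_in_ideal_pow J) auto
  finally show ?thesis .
qed

section \<open>Symbolic powers of determinantal ideals\<close>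

lemma ideal_pow_zero: "ideal_pow {0} (Suc n) = ({0} :: 'a::comm_ring_1 set)"
proof
  have *: "type_ideal {0 :: 'a}" by (simp add: type_ideal_iff)
  show "ideal_pow {0} (Suc n) \<subseteq> {0 :: 'a}"
    by (rule ideal_pow_Suc_subset[OF *]) simp
  show "{0 :: 'a} \<subseteq> ideal_pow {0} (Suc n)"
    using type_ideal_0[OF type_ideal_pow[OF *]] by blast
qed

context matrix_indices
begin

abbreviation xi :: "nat \<Rightarrow> nat \<Rightarrow> ('v \<Rightarrow>\<^sub>0 nat) \<Rightarrow>\<^sub>0 'k::field" where
  "xi i j \<equiv> indet (x i j)"

abbreviation generic_det_ideal :: "nat \<Rightarrow> (('v \<Rightarrow>\<^sub>0 nat) \<Rightarrow>\<^sub>0 'k::field) set" where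
  "generic_det_ideal t \<equiv> det_ideal t (mat r s (\<lambda>(i, j). xi i j))"

lemma type_ideal_det_ideal: "type_ideal (generic_det_ideal t)"
  unfolding det_ideal_def by (rule type_ideal_genideal)

lemma gen_minor_in_det_ideal:
  assumes "\<rho> ` {..<t} \<subseteq> {..<r}" "\<gamma> ` {..<t} \<subseteq> {..<s}"
  shows "gen_minor xi t \<rho> \<gamma> \<in> generic_det_ideal t"
  by (rule gen_minor_in_ideal[OF type_ideal_det_ideal _ assms])
    (simp add: det_ideal_def genideal_superset)

lemma det_ideal_subsetI:
  fixes K :: "(('v \<Rightarrow>\<^sub>0 nat) \<Rightarrow>\<^sub>0 'k::field) set"
  assumes "type_ideal K"
    and "\<And>\<rho> \<gamma>. \<rho> ` {..<t} \<subseteq> {..<r} \<Longrightarrow> \<gamma> ` {..<t} \<subseteq> {..<s} \<Longrightarrow> gen_minor xi t \<rho> \<gamma> \<in> K"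
  shows "generic_det_ideal t \<subseteq> K"
  unfolding det_ideal_def
proof (rule genideal_subset[OF assms(1)], rule subsetI)
  fix y :: "('v \<Rightarrow>\<^sub>0 nat) \<Rightarrow>\<^sub>0 'k"
  assume "y \<in> minors t (mat r s (\<lambda>(i, j). xi i j))"
  then show "y \<in> K" by (rule minorsE) (use assms(2) in auto)
qed

lemma extend_index_image:
  assumes "\<rho> ` {..<k} \<subseteq> {..<n}" "i < n"
  shows "extend_index k \<rho> i ` {..<Suc k} \<subseteq> {..<n}"
  using assms by (auto simp: extend_index_def)

text \<open>After \<open>factor_hom m\<close> the matrix is a product of inner dimension
  \<open>m\<close>, so its \<open>Suc m\<close>-minors vanish: this is
  \<open>gen_minor_in_ideal_pow\<close> with \<open>u = 1\<close>, \<open>J = {0}\<close> and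
  resulting exponent 1.\<close>

lemma det_ideal_subset_rank_ideal:
  "generic_det_ideal (Suc m) \<subseteq> (rank_ideal m :: (('v \<Rightarrow>\<^sub>0 nat) \<Rightarrow>\<^sub>0 'k::field) set)"
proof (rule det_ideal_subsetI)
  show "type_ideal (rank_ideal m :: (('v \<Rightarrow>\<^sub>0 nat) \<Rightarrow>\<^sub>0 'k) set)"
    using primeideal_rank_ideal by (auto simp: primeideal_type_iff)
  fix \<rho> \<gamma> :: "nat \<Rightarrow> nat"
  assume \<rho>\<gamma>: "\<rho> ` {..<Suc m} \<subseteq> {..<r}" "\<gamma> ` {..<Suc m} \<subseteq> {..<s}"
  interpret \<theta>: comm_ring_hom "factor_hom m :: (('v \<Rightarrow>\<^sub>0 nat) \<Rightarrow>\<^sub>0 'k) \<Rightarrow> _" by (rule factor_hom_hom)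
  let ?f = "\<lambda>i j. factor_hom m (xi i j :: ('v \<Rightarrow>\<^sub>0 nat) \<Rightarrow>\<^sub>0 'k)"
  have "1 ^ Suc m * gen_minor ?f (Suc m) \<rho> \<gamma> \<in> ideal_pow {0} (Suc m - m)"
  proof (rule gen_minor_in_ideal_pow)
    show "type_ideal {0 :: (nat \<Rightarrow>\<^sub>0 nat) \<Rightarrow>\<^sub>0 'k}" by (simp add: type_ideal_iff)
    fix a b assume "a < Suc m" "b < Suc m"
    then have "\<rho> a < r" "\<gamma> b < s" using \<rho>\<gamma> by auto
    then show "1 * ?f (\<rho> a) (\<gamma> b)
        - (\<Sum>l<m. indet (left_var (\<rho> a) l) * indet (right_var l (\<gamma> b))) \<in> {0}"
      by (simp add: factor_hom_x)
  qed
  then have "gen_minor ?f (Suc m) \<rho> \<gamma> = 0"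
    by (simp add: ideal_pow_zero)
  then show "gen_minor xi (Suc m) \<rho> \<gamma> \<in> (rank_ideal m :: (('v \<Rightarrow>\<^sub>0 nat) \<Rightarrow>\<^sub>0 'k) set)"
    by (simp add: rank_ideal_def \<theta>.hom_gen_minor)
qed

text \<open>Specializing \<open>Y\<close> and \<open>Z\<close> to identity blocks padded by zeros
  gives the leading minor the value 1, while every element of \<open>rank_ideal m\<close> takes the
  value 0 there.\<close>

lemma leading_minor_notin_rank_ideal:
  assumes "m \<le> r" "m \<le> s"
  shows "gen_minor xi m id id \<notin> (rank_ideal m :: (('v \<Rightarrow>\<^sub>0 nat) \<Rightarrow>\<^sub>0 'k::field) set)"
proof
  assume *: "gen_minor xi m id id \<in> (rank_ideal m :: (('v \<Rightarrow>\<^sub>0 nat) \<Rightarrow>\<^sub>0 'k) set)"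
  define A :: "nat \<Rightarrow> nat \<Rightarrow> 'k" where "A i j = (if i = j then 1 else 0)" for i j
  have id: "comm_ring_hom (\<lambda>a :: 'k. a)" by unfold_locales auto
  let ?ev = "peval (\<lambda>a. a) (\<lambda>v. \<Sum>l<m. A (row_of v) l * A l (col_of v))"
  interpret ev: comm_ring_hom ?ev by (rule peval_hom[OF id])
  have "gen_minor (\<lambda>i j. ?ev (xi i j)) m id id = 1"
  proof -
    have "?ev (xi i j) = (if i = j then 1 else 0)" if "i < m" "j < m" for i j
    proof -
      have "?ev (xi i j) = (\<Sum>l<m. A i l * A l j)"
        using that assms by (simp add: peval_indet[OF id] coord_x)
      also have "\<dots> = (\<Sum>l<m. if l = i then A i j else 0)"
        by (rule sum.cong) (auto simp: A_def)
      finally have "?ev (xi i j) = (\<Sum>l<m. if l = i then A i j else 0)" .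
      then show ?thesis using that by (simp add: A_def)
    qed
    then have "mat m m (\<lambda>(a, b). ?ev (xi (id a) (id b))) = 1\<^sub>m m"
      by (intro eq_matI) auto
    then show ?thesis by (simp add: gen_minor_def)
  qed
  then show False using peval_rank_ideal[OF id *, of A A] by (simp add: ev.hom_gen_minor)
qed

text \<open>
  With \<open>k\<close> maximal such that some \<open>k\<close>-minor \<open>D\<close> is not in \<open>P\<close>, the bordered minors show that \<open>D X\<close>
  is congruent modulo \<open>P\<close> to a product with inner dimension \<open>k\<close>.
\<close>

lemma rank_ideal_subset_prime_over_det_ideal:
  fixes P :: "(('v \<Rightarrow>\<^sub>0 nat) \<Rightarrow>\<^sub>0 'k::field) set"
  assumes P: "primeideal P ring_of_type_algebra" and sub: "generic_det_ideal (Suc m) \<subseteq> P"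
  shows "rank_ideal m \<subseteq> P"
proof -
  define Q where "Q n \<longleftrightarrow> (\<forall>\<rho> \<gamma>. \<rho> ` {..<n} \<subseteq> {..<r} \<longrightarrow> \<gamma> ` {..<n} \<subseteq> {..<s} \<longrightarrow>
     gen_minor xi n \<rho> \<gamma> \<in> P)" for n
  have top: "Q (Suc m)" unfolding Q_def using gen_minor_in_det_ideal sub by blast
  \<comment> \<open>The empty minor is 1. Hence the least \<open>n\<close> with all
    \<open>n\<close>-minors in \<open>P\<close> is a successor \<open>Suc k\<close>, and some
    \<open>k\<close>-minor is outside \<open>P\<close>.\<close>
  have "\<not> Q 0" using prime_ideal_facts(2)[OF P] by (auto simp: Q_def gen_minor_0)
  then have "(LEAST n. Q n) \<noteq> 0" using LeastI[of Q, OF top] by metis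
  then obtain k where k: "(LEAST n. Q n) = Suc k" using not0_implies_Suc by blast
  have Qk: "Q (Suc k)" using LeastI[of Q, OF top] k by simp
  have "k \<le> m" using Least_le[of Q, OF top] k by simp
  have "\<not> Q k" using not_less_Least[of k Q] k by simp
  then obtain \<rho> \<gamma> where \<rho>: "\<rho> ` {..<k} \<subseteq> {..<r}" and \<gamma>: "\<gamma> ` {..<k} \<subseteq> {..<s}"
    and D: "gen_minor xi k \<rho> \<gamma> \<notin> P"
    unfolding Q_def by blast
  have nz: "gen_minor xi k \<rho> \<gamma> \<noteq> (0 :: ('v \<Rightarrow>\<^sub>0 nat) \<Rightarrow>\<^sub>0 'k)"
    using D type_ideal_0[OF prime_ideal_facts(1)[OF P]] by auto
  show ?thesis
  proof (rule rank_ideal_subset_prime[OF P D \<open>k \<le> m\<close>])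
    fix i j assume "i < r" "j < s"
    then have "gen_minor xi (Suc k) (extend_index k \<rho> i) (extend_index k \<gamma> j) \<in> P"
      using Qk \<rho> \<gamma> by (simp add: Q_def extend_index_image)
    then show "gen_minor xi k \<rho> \<gamma> * xi i j - (\<Sum>l<k. (\<Sum>q<k. xi i (\<gamma> q) *
        adj_mat (mat k k (\<lambda>(a, b). xi (\<rho> a) (\<gamma> b))) $$ (q, l)) * xi (\<rho> l) j) \<in> P"
      unfolding bordered_minor[OF nz] by simp
  qed
qed

lemma minimal_primes_det_ideal:
  "minimal_primes (generic_det_ideal (Suc m)) = {rank_ideal m :: (('v \<Rightarrow>\<^sub>0 nat) \<Rightarrow>\<^sub>0 'k::field) set}"
  unfolding minimal_primes_def
  using primeideal_rank_ideal det_ideal_subset_rank_ideal rank_ideal_subset_prime_over_det_ideal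
  by blast

abbreviation det_symbolic_power :: "nat \<Rightarrow> nat \<Rightarrow> (('v \<Rightarrow>\<^sub>0 nat) \<Rightarrow>\<^sub>0 'k::field) set" where
  "det_symbolic_power m n \<equiv> loc_pow (- rank_ideal m) (generic_det_ideal (Suc m)) n"

lemma mult_closed_compl_rank_ideal: "mult_closed (- rank_ideal m)"
  by (intro mult_closed_compl_prime primeideal_rank_ideal)

lemma symbolic_power_det_ideal:
  "symbolic_power (generic_det_ideal (Suc m)) n = det_symbolic_power m n"
  by (rule symbolic_power_eq_loc_pow)
    (simp_all add: type_ideal_det_ideal mult_closed_compl_rank_ideal minimal_primes_det_ideal)

lemma leading_minor_factorization:
  fixes m :: nat and \<Delta> :: "('v \<Rightarrow>\<^sub>0 nat) \<Rightarrow>\<^sub>0 'k::field"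
  defines "\<Delta> \<equiv> gen_minor xi m id id"
  assumes m: "m \<le> r" "m \<le> s"
  shows "\<Delta> * xi i j - (\<Sum>l<m. (\<Sum>q<m. xi i q * adj_mat (mat m m (\<lambda>(a, b). xi a b)) $$ (q, l)) * xi l j)
    = gen_minor xi (Suc m) (extend_index m id i) (extend_index m id j)"
proof -
  have "\<Delta> \<noteq> 0"
    using leading_minor_notin_rank_ideal[OF m]
      type_ideal_0[OF prime_ideal_facts(1)[OF primeideal_rank_ideal]]
    unfolding \<Delta>_def by metis
  then show ?thesis
    using bordered_minor[OF \<open>\<Delta> \<noteq> 0\<close>[unfolded \<Delta>_def], of i j] by (simp add: \<Delta>_def)
qed

text \<open>The bordered minors lie in the determinantal ideal, so \<open>a\<close> factors of the
  leading minor, which is outside \<open>rank_ideal m\<close>, move the \<open>a\<close>-minor into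
  the ordinary power. For \<open>a <= m\<close> the truncated exponent is 0.\<close>

lemma gen_minor_in_symbolic_power:
  assumes m: "m \<le> r" "m \<le> s" and \<rho>: "\<rho> ` {..<a} \<subseteq> {..<r}" and \<gamma>: "\<gamma> ` {..<a} \<subseteq> {..<s}"
  shows "gen_minor xi a \<rho> \<gamma> \<in> (det_symbolic_power m (a - m) :: (('v \<Rightarrow>\<^sub>0 nat) \<Rightarrow>\<^sub>0 'k::field) set)"
proof -
  interpret mult_closed "- rank_ideal m :: (('v \<Rightarrow>\<^sub>0 nat) \<Rightarrow>\<^sub>0 'k) set"
    by (rule mult_closed_compl_rank_ideal)
  let ?\<Delta> = "gen_minor xi m id id :: ('v \<Rightarrow>\<^sub>0 nat) \<Rightarrow>\<^sub>0 'k"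
  have "?\<Delta> ^ a * gen_minor xi a \<rho> \<gamma> \<in> ideal_pow (generic_det_ideal (Suc m)) (a - m)"
  proof (rule gen_minor_in_ideal_pow[OF type_ideal_det_ideal])
    fix c d assume "c < a" "d < a"
    then have "\<rho> c < r" "\<gamma> d < s" using \<rho> \<gamma> by auto
    then show "?\<Delta> * xi (\<rho> c) (\<gamma> d) - (\<Sum>l<m. (\<Sum>q<m. xi (\<rho> c) q *
        adj_mat (mat m m (\<lambda>(a, b). xi a b)) $$ (q, l)) * xi l (\<gamma> d)) \<in> generic_det_ideal (Suc m)"
      unfolding leading_minor_factorization[OF m]
      using m by (intro gen_minor_in_det_ideal extend_index_image) auto
  qed
  moreover have "?\<Delta> ^ a \<in> - rank_ideal m"
    by (rule power_in) (simp add: leading_minor_notin_rank_ideal m)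
  ultimately show ?thesis unfolding loc_pow_def by blast
qed

text \<open>The border runs only through rows and columns of index at least \<open>m\<close>: a
  smaller index repeats a row or a column and gives 0. This brings the number of generators down to
  \<open>(r - m) * (s - m)\<close>.\<close>

definition bordered_generators :: "nat \<Rightarrow> (('v \<Rightarrow>\<^sub>0 nat) \<Rightarrow>\<^sub>0 'k::field) set" where
  "bordered_generators m = (\<lambda>(i, j). gen_minor xi (Suc m) (extend_index m id i) (extend_index m id j))
     ` ({m..<r} \<times> {m..<s})"

lemma finite_bordered_generators: "finite (bordered_generators m)"
  by (simp add: bordered_generators_def)

lemma card_bordered_generators: "card (bordered_generators m) \<le> (r - m) * (s - m)"
  unfolding bordered_generators_def
  by (rule order_trans[OF card_image_le]) simp_all

lemma bordered_generators_subset: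
  assumes m: "m \<le> r" "m \<le> s"
  shows "bordered_generators m \<subseteq> generic_det_ideal (Suc m)"
proof
  fix y assume "y \<in> bordered_generators m"
  then obtain i j where "i < r" "j < s"
    and y: "y = gen_minor xi (Suc m) (extend_index m id i) (extend_index m id j)"
    unfolding bordered_generators_def by auto
  then show "y \<in> generic_det_ideal (Suc m)"
    unfolding y using m by (intro gen_minor_in_det_ideal extend_index_image) auto
qed

text \<open>By \<open>leading_minor_factorization\<close>, the matrix scaled by the leading minor is
  a product of inner dimension \<open>m\<close> plus a matrix over the ideal of bordered minors. A
  minor of size \<open>Suc m\<close> therefore lands in its first power.\<close>

lemma det_ideal_locally_generated:
  fixes y :: "('v \<Rightarrow>\<^sub>0 nat) \<Rightarrow>\<^sub>0 'k::field"
  assumes m: "m \<le> r" "m \<le> s" and y: "y \<in> generic_det_ideal (Suc m)"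
  shows "gen_minor xi m id id ^ Suc m * y \<in> genideal ring_of_type_algebra (bordered_generators m)"
proof -
  let ?J = "genideal ring_of_type_algebra (bordered_generators m :: (('v \<Rightarrow>\<^sub>0 nat) \<Rightarrow>\<^sub>0 'k) set)"
  let ?\<Delta> = "gen_minor xi m id id :: ('v \<Rightarrow>\<^sub>0 nat) \<Rightarrow>\<^sub>0 'k"
  have J: "type_ideal ?J" by (rule type_ideal_genideal)
  have G: "gen_minor xi (Suc m) (extend_index m id i) (extend_index m id j) \<in> ?J"
    if "i < r" "j < s" for i j
  proof (cases "m \<le> i \<and> m \<le> j")
    case True
    then have "gen_minor xi (Suc m) (extend_index m id i) (extend_index m id j) \<in>
        (bordered_generators m :: (('v \<Rightarrow>\<^sub>0 nat) \<Rightarrow>\<^sub>0 'k) set)"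
      using that unfolding bordered_generators_def by auto
    then show ?thesis using genideal_superset by blast
  next
    case False
    have not_inj: "\<not> inj_on (extend_index m id i) {..<Suc m}" if "i < m" for i
    proof
      assume "inj_on (extend_index m id i) {..<Suc m}"
      moreover have "extend_index m id i m = extend_index m id i i"
        using that by (simp add: extend_index_def)
      ultimately have "m = i" by (rule inj_onD) (use that in simp_all)
      then show False using that by simp
    qed
    have "gen_minor xi (Suc m) (extend_index m id i) (extend_index m id j) = (0 :: ('v \<Rightarrow>\<^sub>0 nat) \<Rightarrow>\<^sub>0 'k)"
    proof (cases "i < m")
      case True
      then show ?thesis by (intro gen_minor_not_inj not_inj)
    next
      case False
      then have "j < m" using \<open>\<not> (m \<le> i \<and> m \<le> j)\<close> by simp
      then show ?thesis
        unfolding gen_minor_transpose[of xi] by (intro gen_minor_not_inj not_inj)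
    qed
    then show ?thesis using type_ideal_0[OF J] by simp
  qed
  have "generic_det_ideal (Suc m) \<subseteq> {y. ?\<Delta> ^ Suc m * y \<in> ?J}"
  proof (rule det_ideal_subsetI[OF type_ideal_scale_vimage[OF J]])
    fix \<rho> \<gamma> :: "nat \<Rightarrow> nat"
    assume \<rho>\<gamma>: "\<rho> ` {..<Suc m} \<subseteq> {..<r}" "\<gamma> ` {..<Suc m} \<subseteq> {..<s}"
    have "?\<Delta> ^ Suc m * gen_minor xi (Suc m) \<rho> \<gamma> \<in> ideal_pow ?J (Suc m - m)"
    proof (rule gen_minor_in_ideal_pow[OF J])
      fix c d assume "c < Suc m" "d < Suc m"
      then have "\<rho> c < r" "\<gamma> d < s" using \<rho>\<gamma> by auto
      then show "?\<Delta> * xi (\<rho> c) (\<gamma> d) - (\<Sum>l<m. (\<Sum>q<m. xi (\<rho> c) q *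
          adj_mat (mat m m (\<lambda>(a, b). xi a b)) $$ (q, l)) * xi l (\<gamma> d)) \<in> ?J"
        unfolding leading_minor_factorization[OF m] by (rule G)
    qed
    then show "gen_minor xi (Suc m) \<rho> \<gamma> \<in> {y. ?\<Delta> ^ Suc m * y \<in> ?J}"
      using ideal_pow_1[OF J] by simp
  qed
  then show ?thesis using y by blast
qed

end

section \<open>The product of the diagonal minors\<close>

text \<open>This forces coefficient 1 at \<open>m\<close> and weight strictly below
  \<open>w m\<close> at all other monomials. A weight takes the place of a monomial order.\<close>

definition has_lead :: "(('v \<Rightarrow>\<^sub>0 nat) \<Rightarrow> nat) \<Rightarrow> (('v \<Rightarrow>\<^sub>0 nat) \<Rightarrow>\<^sub>0 'k::comm_ring_1) \<Rightarrow> ('v \<Rightarrow>\<^sub>0 nat) \<Rightarrow> bool" where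
  "has_lead w g m \<longleftrightarrow> (\<forall>n\<in>Poly_Mapping.keys (g - Poly_Mapping.single m 1). w n < w m)"

lemma has_lead_one: "w 0 = 0 \<Longrightarrow> has_lead w 1 0"
  by (simp add: has_lead_def)

lemma has_lead_mult:
  fixes f g :: "('a \<Rightarrow>\<^sub>0 nat) \<Rightarrow>\<^sub>0 'b::comm_ring_1"
  assumes w: "\<And>m n. w (m + n) = w m + w n" and f: "has_lead w f m" and g: "has_lead w g n"
  shows "has_lead w (f * g) (m + n)"
proof -
  let ?M = "Poly_Mapping.single m 1" and ?N = "Poly_Mapping.single n 1"
  \<comment> \<open>In each of the three summands at least one factor has only monomials strictly
    lighter than the corresponding leading one.\<close>
  have "f * g - Poly_Mapping.single (m + n) 1 = (f - ?M) * (g - ?N) + (f - ?M) * ?N + ?M * (g - ?N)"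
    by (simp add: algebra_simps mult_single)
  then have sub: "Poly_Mapping.keys (f * g - Poly_Mapping.single (m + n) 1) \<subseteq>
      Poly_Mapping.keys ((f - ?M) * (g - ?N)) \<union> Poly_Mapping.keys ((f - ?M) * ?N)
      \<union> Poly_Mapping.keys (?M * (g - ?N))"
    using keys_add[of "(f - ?M) * (g - ?N) + (f - ?M) * ?N" "?M * (g - ?N)"]
      keys_add[of "(f - ?M) * (g - ?N)" "(f - ?M) * ?N"] by auto
  have less: "w a < w m" if "a \<in> Poly_Mapping.keys (f - ?M)" for a
    using f that by (simp add: has_lead_def)
  have less': "w b < w n" if "b \<in> Poly_Mapping.keys (g - ?N)" for b
    using g that by (simp add: has_lead_def)
  have split: "\<exists>a\<in>Poly_Mapping.keys p. \<exists>b\<in>Poly_Mapping.keys q. k = a + b"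
    if "k \<in> Poly_Mapping.keys (p * q)" for k and p q :: "('a \<Rightarrow>\<^sub>0 nat) \<Rightarrow>\<^sub>0 'b"
    using keys_mult[of p q] that by blast
  show ?thesis
    unfolding has_lead_def
  proof
    fix k assume "k \<in> Poly_Mapping.keys (f * g - Poly_Mapping.single (m + n) 1)"
    then consider "k \<in> Poly_Mapping.keys ((f - ?M) * (g - ?N))" | "k \<in> Poly_Mapping.keys ((f - ?M) * ?N)"
      | "k \<in> Poly_Mapping.keys (?M * (g - ?N))"
      using sub by blast
    then show "w k < w (m + n)"
    proof cases
      case 1
      from split[OF this] show ?thesis using less less' by (force simp: w intro: add_strict_mono)
    next
      case 2
      from split[OF this] show ?thesis using less by (auto simp: w split: if_splits)
    next
      case 3
      from split[OF this] show ?thesis using less' by (auto simp: w split: if_splits)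
    qed
  qed
qed

lemma has_lead_prod:
  assumes "\<And>m n. w (m + n) = w m + w n" "w 0 = 0" "\<And>i. i \<in> A \<Longrightarrow> has_lead w (f i) (m i)"
  shows "has_lead w (prod f A) (sum m A)"
  using assms(3) by (induction A rule: infinite_finite_induct)
    (auto intro: has_lead_one has_lead_mult assms(1,2))

lemma has_lead_lookup:
  assumes "has_lead w g m"
  shows "Poly_Mapping.lookup g m = 1"
    and "w m \<le> w n \<Longrightarrow> n \<noteq> m \<Longrightarrow> Poly_Mapping.lookup g n = 0"
proof -
  have *: "w m \<le> w n \<Longrightarrow> Poly_Mapping.lookup (g - Poly_Mapping.single m 1) n = 0" for n
    using assms by (auto simp: has_lead_def in_keys_iff not_less[symmetric])
  show "Poly_Mapping.lookup g m = 1" using *[of m] by (simp add: lookup_minus)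
  show "w m \<le> w n \<Longrightarrow> n \<noteq> m \<Longrightarrow> Poly_Mapping.lookup g n = 0"
    using *[of n] by (simp add: lookup_minus lookup_single_not_eq)
qed

text \<open>Each position lies on exactly one diagonal. Diagonal \<open>d\<close> consists of the
  positions with \<open>j - i + r - 1 = d\<close>, from the lower left corner at
  \<open>d = 0\<close>; the truncated differences give its first position, and
  \<open>b = min i j\<close> is the place along it.\<close>

lemma diagonal_sum:
  fixes h :: "nat \<Rightarrow> nat \<Rightarrow> 'a::comm_monoid_add"
  assumes "0 < r" "0 < s"
  shows "(\<Sum>d<r + s - 1. \<Sum>b<min (r - (r - 1 - d)) (s - (d - (r - 1))). h (r - 1 - d + b) (d - (r - 1) + b))
    = (\<Sum>i<r. \<Sum>j<s. h i j)"
proof -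
  let ?a = "\<lambda>d. min (r - (r - 1 - d)) (s - (d - (r - 1)))"
  have 1: "r - 1 - d + b < r" "d - (r - 1) + b < s"
      "d - (r - 1) + b + (r - 1) - (r - 1 - d + b) = d" "min (r - 1 - d + b) (d - (r - 1) + b) = b"
    if "d < r + s - 1" "b < ?a d" for d b
  proof -
    have "r - 1 - d + b < r \<and> d - (r - 1) + b < s \<and>
      d - (r - 1) + b + (r - 1) - (r - 1 - d + b) = d \<and> min (r - 1 - d + b) (d - (r - 1) + b) = b"
    proof (cases "d \<le> r - 1")
      case True
      then obtain e where e: "r - 1 = d + e" using le_Suc_ex by blast
      then have "r = Suc (d + e)" using assms(1) by simp
      then show ?thesis using that by simp
    next
      case False
      then obtain e where e: "d = r - 1 + e" using le_Suc_ex nat_le_linear by blast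
      then show ?thesis using that assms(1) by (cases r) auto
    qed
    then show "r - 1 - d + b < r" "d - (r - 1) + b < s"
      "d - (r - 1) + b + (r - 1) - (r - 1 - d + b) = d" "min (r - 1 - d + b) (d - (r - 1) + b) = b"
      by blast+
  qed
  have 2: "r - 1 - (j + (r - 1) - i) + min i j = i" "j + (r - 1) - i - (r - 1) + min i j = j"
      "j + (r - 1) - i < r + s - 1" "min i j < ?a (j + (r - 1) - i)" if "i < r" "j < s" for i j
  proof -
    have "r - 1 - (j + (r - 1) - i) + min i j = i \<and> j + (r - 1) - i - (r - 1) + min i j = j \<and>
      j + (r - 1) - i < r + s - 1 \<and> min i j < ?a (j + (r - 1) - i)"
    proof (cases "i \<le> j")
      case True
      then obtain e where "j = i + e" using le_Suc_ex by blast
      then show ?thesis using that by auto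
    next
      case False
      then obtain e where e: "i = j + e" using le_Suc_ex nat_le_linear by blast
      then obtain q where "r = Suc (j + e + q)" using \<open>i < r\<close> less_iff_Suc_add by auto
      then show ?thesis using that e by simp
    qed
    then show "r - 1 - (j + (r - 1) - i) + min i j = i" "j + (r - 1) - i - (r - 1) + min i j = j"
      "j + (r - 1) - i < r + s - 1" "min i j < ?a (j + (r - 1) - i)"
      by blast+
  qed
  have "(\<Sum>(d, b)\<in>(SIGMA d:{..<r + s - 1}. {..<?a d}). h (r - 1 - d + b) (d - (r - 1) + b))
      = (\<Sum>(i, j)\<in>{..<r} \<times> {..<s}. h i j)"
  proof (rule sum.reindex_bij_witness[where
        i = "\<lambda>(i, j). (j + (r - 1) - i, min i j)" and j = "\<lambda>(d, b). (r - 1 - d + b, d - (r - 1) + b)"])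
    fix z assume "z \<in> (SIGMA d:{..<r + s - 1}. {..<?a d})"
    then obtain d b where z: "z = (d, b)" "d < r + s - 1" "b < ?a d" by blast
    show "(case case z of (d, b) \<Rightarrow> (r - 1 - d + b, d - (r - 1) + b) of
        (i, j) \<Rightarrow> (j + (r - 1) - i, min i j)) = z"
      unfolding z(1) prod.case by (simp only: 1[OF z(2,3)])
    show "(case z of (d, b) \<Rightarrow> (r - 1 - d + b, d - (r - 1) + b)) \<in> {..<r} \<times> {..<s}"
      unfolding z(1) prod.case using 1(1,2)[OF z(2,3)] by blast
    show "(case case z of (d, b) \<Rightarrow> (r - 1 - d + b, d - (r - 1) + b) of (i, j) \<Rightarrow> h i j)
        = (case z of (d, b) \<Rightarrow> h (r - 1 - d + b) (d - (r - 1) + b))"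
      unfolding z(1) prod.case by (rule refl)
  next
    fix z assume "z \<in> {..<r} \<times> {..<s}"
    then obtain i j where z: "z = (i, j)" "i < r" "j < s" by blast
    show "(case case z of (i, j) \<Rightarrow> (j + (r - 1) - i, min i j) of
        (d, b) \<Rightarrow> (r - 1 - d + b, d - (r - 1) + b)) = z"
      unfolding z(1) prod.case by (simp only: 2[OF z(2,3)])
    show "(case z of (i, j) \<Rightarrow> (j + (r - 1) - i, min i j)) \<in> (SIGMA d:{..<r + s - 1}. {..<?a d})"
      unfolding z(1) prod.case using 2(3,4)[OF z(2,3)] by blast
  qed
  then show ?thesis by (simp add: sum.Sigma sum.cartesian_product)
qed

text \<open>A strict rearrangement inequality: the sum of the squares of \<open>a - \<pi> a\<close>
  is positive, and the squares of \<open>\<pi> a\<close> and of \<open>a\<close> have the same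
  sum.\<close>

lemma sum_mult_permutation_less:
  fixes \<pi> :: "nat \<Rightarrow> nat"
  assumes \<pi>: "\<pi> permutes {..<k}" and "\<pi> \<noteq> id"
  shows "(\<Sum>a<k. (i + a) * (j + \<pi> a)) < (\<Sum>a<k. (i + a) * (j + a))"
proof -
  have perm: "(\<Sum>a<k. f (\<pi> a)) = (\<Sum>a<k. f a)" for f :: "nat \<Rightarrow> int"
    using sum.permute[OF \<pi>, of f] by (simp add: comp_def)
  obtain a where a: "\<pi> a \<noteq> a" using \<open>\<pi> \<noteq> id\<close> by (auto simp: fun_eq_iff)
  then have "a < k" using permutes_not_in[OF \<pi>] by (metis lessThan_iff)
  have "0 < (\<Sum>a<k. (int a - int (\<pi> a))\<^sup>2)"
    by (rule sum_pos2[of _ a]) (use a \<open>a < k\<close> in auto)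
  also have "\<dots> = (\<Sum>a<k. (int a)\<^sup>2) + (\<Sum>a<k. (int (\<pi> a))\<^sup>2) - 2 * (\<Sum>a<k. int a * int (\<pi> a))"
    by (simp add: power2_diff sum.distrib sum_subtractf sum_distrib_left algebra_simps)
  also have "(\<Sum>a<k. (int (\<pi> a))\<^sup>2) = (\<Sum>a<k. (int a)\<^sup>2)" by (rule perm)
  finally have sq: "(\<Sum>a<k. int a * int (\<pi> a)) < (\<Sum>a<k. int a * int a)"
    by (simp add: power2_eq_square)
  \<comment> \<open>The shifts by \<open>i\<close> and \<open>j\<close> contribute only terms that a
    permutation leaves unchanged.\<close>
  have expand: "(\<Sum>a<k. (int i + int a) * (int j + int (g a)))
      = (\<Sum>a<k. int i * int j) + int j * (\<Sum>a<k. int a) + int i * (\<Sum>a<k. int (g a))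
        + (\<Sum>a<k. int a * int (g a))" for g :: "nat \<Rightarrow> nat"
    by (simp add: algebra_simps sum.distrib sum_distrib_left)
  have "(\<Sum>a<k. int (\<pi> a)) = (\<Sum>a<k. int a)" by (rule perm)
  then have "(\<Sum>a<k. (int i + int a) * (int j + int (\<pi> a))) < (\<Sum>a<k. (int i + int a) * (int j + int a))"
    using sq expand[of \<pi>] expand[of "\<lambda>a. a"] by simp
  then have "int (\<Sum>a<k. (i + a) * (j + \<pi> a)) < int (\<Sum>a<k. (i + a) * (j + a))" by simp
  then show ?thesis by (simp only: of_nat_less_iff)
qed

section \<open>Leading monomials of diagonal minors\<close>

context matrix_indices
begin

lemma finite_UNIV: "finite (UNIV :: 'v set)"
  using bij_betw_finite[OF bij] by simp

definition weight :: "('v \<Rightarrow>\<^sub>0 nat) \<Rightarrow> nat" where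
  "weight m = (\<Sum>v\<in>UNIV. row_of v * col_of v * Poly_Mapping.lookup m v)"

lemma weight_0: "weight 0 = 0"
  by (simp add: weight_def)

lemma weight_add: "weight (m + n) = weight m + weight n"
  by (simp add: weight_def lookup_add distrib_left sum.distrib)

lemma weight_sum: "weight (sum f A) = (\<Sum>i\<in>A. weight (f i))"
  by (induction A rule: infinite_finite_induct) (simp_all add: weight_0 weight_add)

lemma weight_single_x:
  assumes "i < r" "j < s"
  shows "weight (Poly_Mapping.single (x i j) 1) = i * j"
proof -
  have "weight (Poly_Mapping.single (x i j) 1) = (\<Sum>v\<in>UNIV. if v = x i j then i * j else 0)"
    unfolding weight_def by (rule sum.cong) (auto simp: lookup_single when_def coord_x assms)
  then show ?thesis by (simp add: finite_UNIV)
qed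

lemma weight_mono:
  "(\<And>v. Poly_Mapping.lookup m v \<le> Poly_Mapping.lookup n v) \<Longrightarrow> weight m \<le> weight n"
  unfolding weight_def by (intro sum_mono mult_left_mono) auto

text \<open>The Leibniz term of \<open>\<pi>\<close> is, up to sign, a monomial of weight
  \<open>\<Sum>a<k. (i + a) * (j + \<pi> a)\<close>; by rearrangement the identity strictly
  dominates.\<close>

lemma has_lead_diagonal_minor:
  assumes i: "i + k \<le> r" and j: "j + k \<le> s"
  shows "has_lead weight (gen_minor (\<lambda>i j. indet (x i j) :: ('v \<Rightarrow>\<^sub>0 nat) \<Rightarrow>\<^sub>0 'k::field) k (\<lambda>a. i + a) (\<lambda>a. j + a))
    (\<Sum>a<k. Poly_Mapping.single (x (i + a) (j + a)) 1)"
proof -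
  define \<mu> where "\<mu> \<pi> = (\<Sum>a<k. Poly_Mapping.single (x (i + a) (j + \<pi> a)) (1::nat))" for \<pi>
  let ?P = "{\<pi>. \<pi> permutes {..<k}}"
  let ?term = "\<lambda>\<pi>. signof \<pi> * Poly_Mapping.single (\<mu> \<pi>) 1 :: ('v \<Rightarrow>\<^sub>0 nat) \<Rightarrow>\<^sub>0 'k"
  have weight_\<mu>: "weight (\<mu> \<pi>) = (\<Sum>a<k. (i + a) * (j + \<pi> a))" if "\<pi> permutes {..<k}" for \<pi>
    unfolding \<mu>_def weight_sum
  proof (rule sum.cong)
    fix a assume "a \<in> {..<k}"
    moreover from this have "\<pi> a < k" using permutes_in_image[OF that] by blast
    ultimately show "weight (Poly_Mapping.single (x (i + a) (j + \<pi> a)) 1) = (i + a) * (j + \<pi> a)"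
      using i j by (intro weight_single_x) auto
  qed simp
  have prod: "(\<Prod>a<n. indet (x (i + a) (j + \<pi> a)) :: ('v \<Rightarrow>\<^sub>0 nat) \<Rightarrow>\<^sub>0 'k)
      = Poly_Mapping.single (\<Sum>a<n. Poly_Mapping.single (x (i + a) (j + \<pi> a)) 1) 1" for \<pi> n
    by (induction n) (simp_all add: indet_def mult_single)
  have "gen_minor (\<lambda>i j. indet (x i j)) k (\<lambda>a. i + a) (\<lambda>a. j + a) = (\<Sum>\<pi>\<in>?P. ?term \<pi>)"
  proof -
    have "signof \<pi> * (\<Prod>a = 0..<k. mat k k (\<lambda>(a, b). indet (x (i + a) (j + b))) $$ (a, \<pi> a)) = ?term \<pi>"
      if "\<pi> permutes {..<k}" for \<pi>
    proof -
      have "\<pi> a < k" if "a < k" for a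
        using permutes_in_image[OF \<open>\<pi> permutes {..<k}\<close>] that by blast
      then have "(\<Prod>a = 0..<k. mat k k (\<lambda>(a, b). indet (x (i + a) (j + b))) $$ (a, \<pi> a))
        = (\<Prod>a<k. indet (x (i + a) (j + \<pi> a)) :: ('v \<Rightarrow>\<^sub>0 nat) \<Rightarrow>\<^sub>0 'k)"
        by (intro prod.cong) auto
      then show ?thesis by (simp add: prod \<mu>_def)
    qed
    then show ?thesis
      unfolding gen_minor_def det_def by (auto simp: atLeast0LessThan intro!: sum.cong)
  qed
  also have "\<dots> = ?term id + (\<Sum>\<pi>\<in>?P - {id}. ?term \<pi>)"
    by (rule sum.remove) (simp_all add: finite_permutations permutes_id)
  also have "?term id = Poly_Mapping.single (\<mu> id) 1"
    by simp
  finally have "gen_minor (\<lambda>i j. indet (x i j)) k (\<lambda>a. i + a) (\<lambda>a. j + a) - Poly_Mapping.single (\<mu> id) 1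
      = (\<Sum>\<pi>\<in>?P - {id}. ?term \<pi>)" by (simp only: add_diff_cancel_left')
  moreover have "weight n < weight (\<mu> id)" if n': "n \<in> Poly_Mapping.keys (\<Sum>\<pi>\<in>?P - {id}. ?term \<pi>)" for n
  proof -
    obtain \<pi> where \<pi>: "\<pi> permutes {..<k}" "\<pi> \<noteq> id" and n: "n \<in> Poly_Mapping.keys (?term \<pi>)"
      using subsetD[OF Poly_Mapping.keys_sum[of ?term "?P - {id}"] n'] by auto
    have "Poly_Mapping.lookup (?term \<pi>) n \<noteq> 0" using n by (simp add: in_keys_iff)
    then have "n = \<mu> \<pi>"
      by (cases \<pi> rule: sign_cases) (auto simp: lookup_single when_def split: if_splits)
    then show ?thesis
      using sum_mult_permutation_less[OF \<pi>, of i j] weight_\<mu>[OF \<pi>(1)] weight_\<mu>[OF permutes_id]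
      by simp
  qed
  ultimately show ?thesis by (simp add: has_lead_def \<mu>_def)
qed

end

section \<open>The trace map and symbolic F-splittings\<close>

text \<open>Linear maps from \<open>R^(1/p)\<close> to \<open>R\<close>, transported to
  \<open>R\<close> along the Frobenius isomorphism: \<open>T g\<close> stands for the value at the
  \<open>p\<close>-th root of \<open>g\<close>.\<close>

definition inv_frobenius_linear :: "nat \<Rightarrow> ('a::comm_ring_1 \<Rightarrow> 'a) \<Rightarrow> bool" where
  "inv_frobenius_linear p T \<longleftrightarrow>
     (\<forall>a b. T (a + b) = T a + T b) \<and> (\<forall>a b. T (a ^ p * b) = a * T b)"

lemma inv_frobenius_linear_add: "inv_frobenius_linear p T \<Longrightarrow> T (a + b) = T a + T b"
  and inv_frobenius_linear_scale: "inv_frobenius_linear p T \<Longrightarrow> T (a ^ p * b) = a * T b"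
  by (simp_all add: inv_frobenius_linear_def)

lemma inv_frobenius_linear_0: "inv_frobenius_linear p T \<Longrightarrow> T 0 = 0"
  using inv_frobenius_linear_add[of p T 0 0] by simp

text \<open>
  A field of characteristic \<open>p\<close> is a vector space over itself via \<open>a \<cdot> b = a\<^sup>p b\<close>; extend \<open>1\<close> to a basis.
\<close>

lemma ex_inv_frobenius_linear_field:
  assumes "prime p" and char: "CHAR('k::field) = p"
  shows "\<exists>T :: 'k \<Rightarrow> 'k. inv_frobenius_linear p T \<and> T 1 = 1"
proof -
  have frob: "(a + b) ^ p = a ^ p + b ^ p" for a b :: 'k
    using assms by (intro freshmans_dream) auto
  interpret vector_space_pair "\<lambda>a b :: 'k. a ^ p * b" "\<lambda>a b :: 'k. a * b"
    by unfold_locales (simp_all add: algebra_simps frob power_mult_distrib)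
  have "vs1.independent (insert (1::'k) {})"
    by (rule vs1.independent_insertI) (simp_all add: vs1.independent_empty)
  then have indep: "vs1.independent {1::'k}" .
  interpret T: Vector_Spaces.linear "\<lambda>a b :: 'k. a ^ p * b" "\<lambda>a b :: 'k. a * b" "construct {1} (\<lambda>_. 1)"
    by (rule linear_construct[OF indep])
  have "construct {1} (\<lambda>_. 1) (1::'k) = 1"
    by (rule construct_basis[OF indep]) simp
  moreover have "inv_frobenius_linear p (construct {1} (\<lambda>_. 1 :: 'k))"
    unfolding inv_frobenius_linear_def using T.add T.scale by blast
  ultimately show ?thesis by blast
qed

section \<open>The trace map of a polynomial ring\<close>

definition scale_monom :: "nat \<Rightarrow> ('v \<Rightarrow>\<^sub>0 nat) \<Rightarrow> ('v \<Rightarrow>\<^sub>0 nat)" where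
  "scale_monom p m = Poly_Mapping.map ((*) p) m"

lemma lookup_scale_monom: "Poly_Mapping.lookup (scale_monom p m) v = p * Poly_Mapping.lookup m v"
  unfolding scale_monom_def by transfer (simp add: when_def)

lemma scale_monom_add: "scale_monom p (m + n) = scale_monom p m + scale_monom p n"
  by (rule poly_mapping_eqI) (simp add: lookup_scale_monom lookup_add distrib_left)

lemma single_power: "Poly_Mapping.single m a ^ n = Poly_Mapping.single (scale_monom n m) (a ^ n)"
proof (induction n)
  case 0
  have "scale_monom 0 m = 0" by (rule poly_mapping_eqI) (simp add: lookup_scale_monom)
  then show ?case by simp
next
  case (Suc n)
  have "m + scale_monom n m = scale_monom (Suc n) m"
    by (rule poly_mapping_eqI) (simp add: lookup_scale_monom lookup_add)
  then show ?case by (simp add: Suc mult_single)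
qed

text \<open>The exponent of the product of all indeterminates. The constant function 1 has finite
  support only over a finite type, whence the premise of \<open>lookup_all_ones\<close>.\<close>

definition all_ones :: "'v \<Rightarrow>\<^sub>0 nat" where
  "all_ones = Abs_poly_mapping (\<lambda>_. 1)"

lemma lookup_all_ones: "finite (UNIV :: 'v set) \<Longrightarrow> Poly_Mapping.lookup (all_ones :: 'v \<Rightarrow>\<^sub>0 nat) v = 1"
  unfolding all_ones_def by (subst lookup_Abs_poly_mapping) (auto intro: finite_subset)

text \<open>
  On \<open>p\<close>-th roots, \<open>trace_map p \<kappa>\<close> generates \<open>Hom (R\<^sup>1\<^sup>/\<^sup>p, R)\<close> if \<open>\<kappa>\<close> generates \<open>Hom (K\<^sup>1\<^sup>/\<^sup>p, K)\<close>:
  the coefficient at exponent \<open>p n + (p - 1, \<dots>, p - 1)\<close> contributes to the coefficient at \<open>n\<close>.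
\<close>

definition trace_monom :: "nat \<Rightarrow> ('v \<Rightarrow>\<^sub>0 nat) \<Rightarrow> ('v \<Rightarrow>\<^sub>0 nat)" where
  "trace_monom p n = scale_monom p n + scale_monom (p - 1) all_ones"

definition trace_map ::
  "nat \<Rightarrow> ('k::field \<Rightarrow> 'k) \<Rightarrow> (('v \<Rightarrow>\<^sub>0 nat) \<Rightarrow>\<^sub>0 'k) \<Rightarrow> (('v \<Rightarrow>\<^sub>0 nat) \<Rightarrow>\<^sub>0 'k)" where
  "trace_map p \<kappa> g = Poly_Mapping.map \<kappa> (Poly_Mapping.map_key (trace_monom p) g)"

context
  fixes p :: nat and \<kappa> :: "'k::field \<Rightarrow> 'k"
  assumes prime: "prime p" and char: "CHAR('k) = p" and \<kappa>: "inv_frobenius_linear p \<kappa>"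
    and fin: "finite (UNIV :: 'v::linorder set)"
begin

lemma lookup_trace_monom:
  "Poly_Mapping.lookup (trace_monom p n) (v::'v) = p * Poly_Mapping.lookup n v + (p - 1)"
  by (simp add: trace_monom_def lookup_add lookup_scale_monom lookup_all_ones[OF fin])

lemma inj_trace_monom: "inj (trace_monom p :: ('v \<Rightarrow>\<^sub>0 nat) \<Rightarrow> _)"
proof (rule injI, rule poly_mapping_eqI)
  fix m n :: "'v \<Rightarrow>\<^sub>0 nat" and v
  assume "trace_monom p m = trace_monom p n"
  then have "p * Poly_Mapping.lookup m v + (p - 1) = p * Poly_Mapping.lookup n v + (p - 1)"
    by (metis lookup_trace_monom)
  then have "p * Poly_Mapping.lookup m v = p * Poly_Mapping.lookup n v"
    by (simp only: add_right_cancel)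
  then show "Poly_Mapping.lookup m v = Poly_Mapping.lookup n v"
    using prime_gt_0_nat[OF prime] by simp
qed

lemma lookup_trace_map:
  "Poly_Mapping.lookup (trace_map p \<kappa> (g :: ('v \<Rightarrow>\<^sub>0 nat) \<Rightarrow>\<^sub>0 'k)) n
    = \<kappa> (Poly_Mapping.lookup g (trace_monom p n))"
proof -
  have map: "Poly_Mapping.lookup (Poly_Mapping.map \<kappa> h) n = \<kappa> (Poly_Mapping.lookup h n)"
    for h :: "('v \<Rightarrow>\<^sub>0 nat) \<Rightarrow>\<^sub>0 'k"
    using inv_frobenius_linear_0[OF \<kappa>] by transfer (simp add: when_def)
  show ?thesis
    unfolding trace_map_def map map_key.rep_eq[OF inj_trace_monom] by simp
qed

lemma trace_map_add:
  "trace_map p \<kappa> (f + g) = trace_map p \<kappa> f + trace_map p \<kappa> (g :: ('v \<Rightarrow>\<^sub>0 nat) \<Rightarrow>\<^sub>0 'k)"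
  by (rule poly_mapping_eqI)
    (simp add: lookup_trace_map lookup_add inv_frobenius_linear_add[OF \<kappa>])

lemma trace_map_0: "trace_map p \<kappa> (0 :: ('v \<Rightarrow>\<^sub>0 nat) \<Rightarrow>\<^sub>0 'k) = 0"
  by (rule poly_mapping_eqI) (simp add: lookup_trace_map inv_frobenius_linear_0[OF \<kappa>])

lemma trace_map_sum:
  "trace_map p \<kappa> (sum F A) = (\<Sum>i\<in>A. trace_map p \<kappa> (F i :: ('v \<Rightarrow>\<^sub>0 nat) \<Rightarrow>\<^sub>0 'k))"
  by (induction A rule: infinite_finite_induct) (simp_all add: trace_map_0 trace_map_add)

text \<open>A remainder of at most \<open>p - 1\<close> cannot compensate for a missing multiple of
  \<open>p\<close>, so \<open>m\<close> is bounded by \<open>q\<close> pointwise. Multiplying by a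
  \<open>p\<close>-th power of a monomial thus only shifts what the trace map selects.\<close>

lemma trace_monom_eq_scale_add_iff:
  fixes m n q :: "'v \<Rightarrow>\<^sub>0 nat"
  shows "trace_monom p q = scale_monom p m + n \<longleftrightarrow> (\<exists>q'. q = m + q' \<and> n = trace_monom p q')"
proof
  assume eq: "trace_monom p q = scale_monom p m + n"
  have p: "0 < p" using prime by (rule prime_gt_0_nat)
  have pointwise: "p * Poly_Mapping.lookup q v + (p - 1) = p * Poly_Mapping.lookup m v + Poly_Mapping.lookup n v" for v
    using arg_cong[OF eq, of "\<lambda>h. Poly_Mapping.lookup h v"]
    by (simp add: lookup_trace_monom lookup_add lookup_scale_monom)
  have le: "Poly_Mapping.lookup m v \<le> Poly_Mapping.lookup q v" for v
  proof (rule ccontr)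
    assume "\<not> ?thesis"
    then have "p * Suc (Poly_Mapping.lookup q v) \<le> p * Poly_Mapping.lookup m v"
      by (intro mult_le_mono2) simp
    then show False using pointwise[of v] p by simp
  qed
  have "q = m + (q - m)"
    by (rule poly_mapping_eqI) (simp add: lookup_add lookup_minus le)
  moreover have "n = trace_monom p (q - m)"
  proof (rule poly_mapping_eqI)
    fix v
    have "p * Poly_Mapping.lookup q v = p * Poly_Mapping.lookup m v + p * (Poly_Mapping.lookup q v - Poly_Mapping.lookup m v)"
      using le[of v] by (simp add: diff_mult_distrib2)
    then show "Poly_Mapping.lookup n v = Poly_Mapping.lookup (trace_monom p (q - m)) v"
      using pointwise[of v] by (simp add: lookup_trace_monom lookup_minus)
  qed
  ultimately show "\<exists>q'. q = m + q' \<and> n = trace_monom p q'" by blast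
next
  assume "\<exists>q'. q = m + q' \<and> n = trace_monom p q'"
  then show "trace_monom p q = scale_monom p m + n"
    by (auto simp: trace_monom_def scale_monom_add add.assoc)
qed

lemma trace_map_scale_single:
  "trace_map p \<kappa> (Poly_Mapping.single (scale_monom p m) (a ^ p) * Poly_Mapping.single n b)
    = Poly_Mapping.single m a * trace_map p \<kappa> (Poly_Mapping.single (n :: 'v \<Rightarrow>\<^sub>0 nat) b)"
proof (cases "\<exists>q'. n = trace_monom p q'")
  case True
  then obtain q' where n: "n = trace_monom p q'" by blast
  have trace_single: "trace_map p \<kappa> (Poly_Mapping.single (trace_monom p q) c) = Poly_Mapping.single q (\<kappa> c)"
    for q :: "'v \<Rightarrow>\<^sub>0 nat" and c
    by (rule poly_mapping_eqI)
      (auto simp: lookup_trace_map lookup_single when_def inj_eq[OF inj_trace_monom]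
        inv_frobenius_linear_0[OF \<kappa>])
  have "scale_monom p m + n = trace_monom p (m + q')"
    using trace_monom_eq_scale_add_iff[of "m + q'" m n] n by simp
  then show ?thesis
    by (simp add: n mult_single trace_single inv_frobenius_linear_scale[OF \<kappa>])
next
  case False
  have zero: "trace_map p \<kappa> (Poly_Mapping.single k c) = 0" if "\<And>q. trace_monom p q \<noteq> k"
    for k :: "'v \<Rightarrow>\<^sub>0 nat" and c
    using that by (intro poly_mapping_eqI)
      (simp add: lookup_trace_map lookup_single when_def inv_frobenius_linear_0[OF \<kappa>] eq_commute)
  have "trace_monom p q \<noteq> n" "trace_monom p q \<noteq> scale_monom p m + n" for q
    using False trace_monom_eq_scale_add_iff[of q m n] by auto
  then show ?thesis by (simp add: mult_single zero)
qed

lemma CHAR_poly_mapping: "CHAR(('v \<Rightarrow>\<^sub>0 nat) \<Rightarrow>\<^sub>0 'k) = p"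
proof (rule CHAR_eqI)
  have of_nat: "of_nat n = (Poly_Mapping.single 0 (of_nat n) :: ('v \<Rightarrow>\<^sub>0 nat) \<Rightarrow>\<^sub>0 'k)" for n
    by (simp add: single_of_nat)
  show "of_nat p = (0 :: ('v \<Rightarrow>\<^sub>0 nat) \<Rightarrow>\<^sub>0 'k)"
    unfolding of_nat using char by (metis of_nat_CHAR single_zero)
  fix n assume "of_nat n = (0 :: ('v \<Rightarrow>\<^sub>0 nat) \<Rightarrow>\<^sub>0 'k)"
  then have "of_nat n = (0 :: 'k)"
    unfolding of_nat by (metis lookup_single_eq lookup_zero)
  then show "p dvd n" using char by (simp add: of_nat_eq_0_iff_char_dvd)
qed

text \<open>In characteristic \<open>p\<close> the power \<open>a ^ p\<close> is the sum of the
  \<open>p\<close>-th powers of the terms of \<open>a\<close>, which reduces the claim to pairs of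
  terms.\<close>

lemma inv_frobenius_linear_trace_map:
  "inv_frobenius_linear p (trace_map p \<kappa> :: (('v \<Rightarrow>\<^sub>0 nat) \<Rightarrow>\<^sub>0 'k) \<Rightarrow> _)"
  unfolding inv_frobenius_linear_def
proof (intro conjI allI trace_map_add)
  fix a b :: "('v \<Rightarrow>\<^sub>0 nat) \<Rightarrow>\<^sub>0 'k"
  let ?s = "\<lambda>g m. Poly_Mapping.single m (Poly_Mapping.lookup g m)"
  let ?A = "Poly_Mapping.keys a" and ?B = "Poly_Mapping.keys b"
  have a: "a = (\<Sum>m\<in>?A. ?s a m)" and b: "b = (\<Sum>m\<in>?B. ?s b m)"
    by (simp_all add: poly_mapping_sum_single)
  have "a ^ p = (\<Sum>m\<in>?A. Poly_Mapping.single (scale_monom p m) (Poly_Mapping.lookup a m ^ p))"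
    by (subst a, subst freshmans_dream_sum) (simp_all add: CHAR_poly_mapping prime single_power)
  then have "a ^ p * b = (\<Sum>m\<in>?A. \<Sum>n\<in>?B.
      Poly_Mapping.single (scale_monom p m) (Poly_Mapping.lookup a m ^ p) * ?s b n)"
    by (subst b) (simp add: sum_product)
  then have "trace_map p \<kappa> (a ^ p * b) = (\<Sum>m\<in>?A. \<Sum>n\<in>?B. ?s a m * trace_map p \<kappa> (?s b n))"
    by (simp add: trace_map_sum trace_map_scale_single)
  also have "\<dots> = (\<Sum>m\<in>?A. ?s a m) * trace_map p \<kappa> (\<Sum>n\<in>?B. ?s b n)"
    by (simp only: trace_map_sum sum_product)
  also have "\<dots> = a * trace_map p \<kappa> b"
    by (simp only: poly_mapping_sum_single)
  finally show "trace_map p \<kappa> (a ^ p * b) = a * trace_map p \<kappa> b" .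
qed

end

lemma CHAR_fract: "CHAR('a::idom fract) = CHAR('a)"
proof (rule CHAR_eqI)
  have of_nat: "of_nat n = to_fract (of_nat n :: 'a)" for n
    by (induction n) simp_all
  show "of_nat CHAR('a) = (0 :: 'a fract)" by (simp add: of_nat)
  show "CHAR('a) dvd n" if "of_nat n = (0 :: 'a fract)" for n
    using that by (simp add: of_nat of_nat_eq_0_iff_char_dvd)
qed

text \<open>The splitting sends \<open>y\<close> to \<open>T (f * y ^ p)\<close>, with
  \<open>y ^ p\<close> read in the base ring. It fixes \<open>a\<close> because
  \<open>T (f * a ^ p) = a * T f = a\<close>.\<close>

lemma symbolic_F_splitI:
  fixes T :: "'a::idom \<Rightarrow> 'a"
  assumes prime: "prime p" and char: "CHAR('a) = p" and T: "inv_frobenius_linear p T" and f: "T f = 1"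
    and sym: "\<And>n y. y \<in> symbolic_power I (n * p + 1) \<Longrightarrow> T (f * y) \<in> symbolic_power I (n + 1)"
  shows "symbolic_F_split p I"
proof -
  have emb_add: "base_emb (a + b) = base_emb a + base_emb b"
    and emb_mult: "base_emb (a * b) = base_emb a * base_emb b"
    and emb_power: "base_emb (a ^ n) = base_emb a ^ n"
    and emb_inj: "base_emb a = base_emb b \<longleftrightarrow> a = b" for a b :: 'a and n
  proof -
    show mult: "base_emb (a * b) = base_emb a * base_emb b" for a b :: 'a
      by (simp add: base_emb_def)
    show "base_emb (a ^ n) = base_emb a ^ n"
      by (induction n) (simp_all add: mult, simp add: base_emb_def)
  qed (simp_all add: base_emb_def)
  \<comment> \<open>Injectivity of \<open>base_emb\<close> makes the description unique on
    \<open>pth_roots p UNIV\<close>.\<close>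
  define root where "root y = (THE g :: 'a. y ^ p = base_emb g)" for y
  have root: "root y = g" if "y ^ p = base_emb g" for y g
    unfolding root_def using that by (intro the_equality) (simp_all add: emb_inj)
  define \<phi> where "\<phi> y = T (f * root y)" for y
  have frob: "(y + z) ^ p = y ^ p + z ^ p" for y z :: "'a fract alg_closure"
    by (rule freshmans_dream) (simp_all add: CHAR_fract char prime)
  have "linear_on_pth_roots p \<phi>"
    unfolding linear_on_pth_roots_def
  proof (intro conjI ballI allI)
    fix y z :: "'a fract alg_closure"
    assume "y \<in> pth_roots p UNIV" "z \<in> pth_roots p UNIV"
    then obtain g h where "y ^ p = base_emb g" "z ^ p = base_emb h" by (auto simp: pth_roots_def)
    moreover from this have "(y + z) ^ p = base_emb (g + h)" by (simp add: frob emb_add)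
    ultimately show "\<phi> (y + z) = \<phi> y + \<phi> z"
      by (simp add: \<phi>_def root distrib_left inv_frobenius_linear_add[OF T])
  next
    fix a and y :: "'a fract alg_closure"
    assume "y \<in> pth_roots p UNIV"
    then obtain g where "y ^ p = base_emb g" by (auto simp: pth_roots_def)
    moreover from this have "(base_emb a * y) ^ p = base_emb (a ^ p * g)"
      by (simp add: power_mult_distrib emb_mult emb_power)
    ultimately show "\<phi> (base_emb a * y) = a * \<phi> y"
      using inv_frobenius_linear_scale[OF T, of a "f * g"] by (simp add: \<phi>_def root mult.left_commute)
  qed
  moreover have "\<phi> (base_emb a) = a" for a
    using inv_frobenius_linear_scale[OF T, of a f] f
    by (simp add: \<phi>_def root[of _ "a ^ p"] emb_power mult.commute)
  moreover have "\<phi> ` pth_roots p (symbolic_power I (n * p + 1)) \<subseteq> symbolic_power I (n + 1)" for n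
    using sym[of _ n] by (auto simp: pth_roots_def \<phi>_def root)
  ultimately show ?thesis unfolding symbolic_F_split_def by blast
qed

text \<open>
  The local argument: where \<open>I\<close> is generated by \<open>h\<close> elements, \<open>f\<^sup>p\<^sup>-\<^sup>1 I\<^sup>(\<^sup>n\<^sup>p\<^sup>+\<^sup>1\<^sup>)\<close> lies in
  \<open>I\<^sup>h\<^sup>(\<^sup>p\<^sup>-\<^sup>1\<^sup>)\<^sup>+\<^sup>n\<^sup>p\<^sup>+\<^sup>1\<close> and hence in the ideal generated by the \<open>p\<close>-th powers of elements of \<open>I\<^sup>n\<^sup>+\<^sup>1\<close>.
\<close>

lemma (in mult_closed) inv_frobenius_linear_loc_pow:
  assumes p: "0 < p" and T: "inv_frobenius_linear p T"
    and I: "type_ideal I" and G: "finite G" "card G \<le> h" "G \<subseteq> I"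
    and u: "u \<in> S" "\<And>y. y \<in> I \<Longrightarrow> u * y \<in> genideal ring_of_type_algebra G"
    and f: "f \<in> loc_pow S I h" and y: "y \<in> loc_pow S I (n * p + 1)"
  shows "T (f ^ (p - 1) * y) \<in> loc_pow S I (n + 1)"
proof -
  let ?J = "genideal ring_of_type_algebra G" and ?N = "(p - 1) * h + (n * p + 1)"
  have J: "type_ideal ?J" by (rule type_ideal_genideal)
  define z where "z = f ^ (p - 1) * y"
  have "z \<in> loc_pow S I ?N"
    unfolding z_def by (intro loc_pow_mult loc_pow_power I f y)
  then obtain s where s: "s \<in> S" "s * z \<in> ideal_pow I ?N" by (auto simp: loc_pow_def)
  define t where "t = u ^ ?N * s"
  have "t \<in> S" unfolding t_def by (intro mult_in power_in u s)
  have "t * z \<in> ideal_pow ?J ?N"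
    using ideal_pow_scale_subset[OF J u(2) s(2)] by (simp only: t_def mult.assoc)
  \<comment> \<open>The denominator is completed to a \<open>p\<close>-th power so that
    \<open>T\<close> can release it: \<open>T (t ^ p * z) = t * T z\<close>.\<close>
  then have "t ^ (p - 1) * (t * z) \<in> ideal_pow ?J ?N"
    by (rule type_ideal_mult[OF type_ideal_pow[OF J]])
  moreover have "t ^ (p - 1) * (t * z) = t ^ p * z"
    using p by (cases p) (simp_all add: mult_ac)
  ultimately have tz: "t ^ p * z \<in> ideal_pow ?J ?N" by (simp only:)
  \<comment> \<open>The largest ideal that \<open>T\<close> maps into
    \<open>ideal_pow ?J (n + 1)\<close>. By linearity it contains the \<open>p\<close>-th powers of
    the elements of that ideal, as the pigeonhole lemma requires.\<close>
  define K where "K = {w. \<forall>r. T (w * r) \<in> ideal_pow ?J (n + 1)}"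
  have "type_ideal K"
    unfolding type_ideal_iff
  proof (intro conjI ballI allI)
    show "0 \<in> K"
      using type_ideal_0[OF type_ideal_pow[OF J]] by (simp add: K_def inv_frobenius_linear_0[OF T])
    show "v + w \<in> K" if "v \<in> K" "w \<in> K" for v w
      using that type_ideal_add[OF type_ideal_pow[OF J]]
      by (simp add: K_def distrib_right inv_frobenius_linear_add[OF T])
    show "c * w \<in> K" if w: "w \<in> K" for c w
      unfolding K_def
    proof (intro CollectI allI)
      fix r
      have "T (w * (c * r)) \<in> ideal_pow ?J (n + 1)" using w unfolding K_def by blast
      then show "T (c * w * r) \<in> ideal_pow ?J (n + 1)" by (simp only: mult_ac)
    qed
  qed
  have "ideal_pow ?J ?N \<subseteq> K"
  proof (rule genideal_pow_subset_frobenius[OF G(1) p _ \<open>type_ideal K\<close>])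
    show "n * p + 1 + card G * (p - 1) \<le> ?N" using G(2) by (simp add: mult.commute)
    show "w ^ p \<in> K" if "w \<in> ideal_pow ?J (n + 1)" for w
      using type_ideal_mult2[OF type_ideal_pow[OF J] that]
      by (simp add: K_def inv_frobenius_linear_scale[OF T])
  qed
  then have "T (t ^ p * z * 1) \<in> ideal_pow ?J (n + 1)"
    using tz unfolding K_def by blast
  then have "t * T z \<in> ideal_pow ?J (n + 1)"
    by (simp add: inv_frobenius_linear_scale[OF T])
  moreover have "ideal_pow ?J (n + 1) \<subseteq> ideal_pow I (n + 1)"
    by (intro ideal_pow_mono genideal_subset I G)
  ultimately show ?thesis
    using \<open>t \<in> S\<close> unfolding loc_pow_def z_def by blast
qed

section \<open>The splitting for determinantal ideals\<close>

context matrix_indices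
begin

definition diagonal_product :: "('v \<Rightarrow>\<^sub>0 nat) \<Rightarrow>\<^sub>0 'k::field" where
  "diagonal_product = (\<Prod>d<r + s - 1. gen_minor xi (min (r - (r - 1 - d)) (s - (d - (r - 1))))
     (\<lambda>a. r - 1 - d + a) (\<lambda>a. d - (r - 1) + a))"

text \<open>Leading monomials multiply, and the diagonals together pass through each matrix entry
  once.\<close>

lemma has_lead_diagonal_product:
  assumes "0 < r" "0 < s"
  shows "has_lead weight (diagonal_product :: ('v \<Rightarrow>\<^sub>0 nat) \<Rightarrow>\<^sub>0 'k::field) all_ones"
proof -
  have "has_lead weight (diagonal_product :: ('v \<Rightarrow>\<^sub>0 nat) \<Rightarrow>\<^sub>0 'k)
    (\<Sum>d<r + s - 1. \<Sum>a<min (r - (r - 1 - d)) (s - (d - (r - 1))).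
        Poly_Mapping.single (x (r - 1 - d + a) (d - (r - 1) + a)) 1)"
    unfolding diagonal_product_def
  proof (rule has_lead_prod)
    fix d assume "d \<in> {..<r + s - 1}"
    then have "d - (r - 1) \<le> s" by auto
    then show "has_lead weight (gen_minor xi (min (r - (r - 1 - d)) (s - (d - (r - 1))))
        (\<lambda>a. r - 1 - d + a) (\<lambda>a. d - (r - 1) + a) :: ('v \<Rightarrow>\<^sub>0 nat) \<Rightarrow>\<^sub>0 'k)
      (\<Sum>a<min (r - (r - 1 - d)) (s - (d - (r - 1))).
        Poly_Mapping.single (x (r - 1 - d + a) (d - (r - 1) + a)) 1)"
      by (intro has_lead_diagonal_minor) (use assms in auto)
  qed (simp_all add: weight_0 weight_add)
  also have "(\<Sum>d<r + s - 1. \<Sum>a<min (r - (r - 1 - d)) (s - (d - (r - 1))).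
        Poly_Mapping.single (x (r - 1 - d + a) (d - (r - 1) + a)) 1)
    = (\<Sum>i<r. \<Sum>j<s. Poly_Mapping.single (x i j) (1::nat))"
    by (rule diagonal_sum[OF assms])
  also have "\<dots> = (\<Sum>v\<in>UNIV. Poly_Mapping.single v 1)"
    using sum.reindex_bij_betw[OF bij, of "\<lambda>v. Poly_Mapping.single v (1::nat)"]
    by (simp add: sum.cartesian_product case_prod_unfold)
  also have "\<dots> = all_ones"
  proof (rule poly_mapping_eqI)
    fix v :: 'v
    have "Poly_Mapping.lookup (\<Sum>v\<in>UNIV. Poly_Mapping.single v (1::nat)) v
        = (\<Sum>u\<in>UNIV. if u = v then 1 else 0)"
      unfolding lookup_sum by (rule sum.cong) (auto simp: lookup_single when_def)
    then show "Poly_Mapping.lookup (\<Sum>v\<in>UNIV. Poly_Mapping.single v (1::nat)) v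
        = Poly_Mapping.lookup all_ones v"
      by (simp add: finite_UNIV lookup_all_ones)
  qed
  finally show ?thesis .
qed

lemma diagonal_product_in_symbolic_power:
  assumes m: "m < r" "m < s"
  shows "diagonal_product \<in> (det_symbolic_power m ((r - m) * (s - m)) :: (('v \<Rightarrow>\<^sub>0 nat) \<Rightarrow>\<^sub>0 'k::field) set)"
proof -
  interpret mult_closed "- rank_ideal m :: (('v \<Rightarrow>\<^sub>0 nat) \<Rightarrow>\<^sub>0 'k) set"
    by (rule mult_closed_compl_rank_ideal)
  let ?a = "\<lambda>d. min (r - (r - 1 - d)) (s - (d - (r - 1)))"
  have "diagonal_product \<in> (det_symbolic_power m (\<Sum>d<r + s - 1. ?a d - m) :: (('v \<Rightarrow>\<^sub>0 nat) \<Rightarrow>\<^sub>0 'k) set)"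
    unfolding diagonal_product_def
  proof (intro loc_pow_prod type_ideal_det_ideal gen_minor_in_symbolic_power)
    fix d
    show "(\<lambda>a. r - 1 - d + a) ` {..<?a d} \<subseteq> {..<r}" "(\<lambda>a. d - (r - 1) + a) ` {..<?a d} \<subseteq> {..<s}"
      by auto
  qed (use m in auto)
  moreover have "(\<Sum>d<r + s - 1. ?a d - m) = (r - m) * (s - m)"
  proof -
    have count: "(\<Sum>b<n. if b + m < n then 1 else 0) = n - m" for n
    proof -
      have "{..<n} \<inter> {b. b + m < n} = {..<n - m}" by auto
      then show ?thesis by (simp add: sum.If_cases)
    qed
    \<comment> \<open>A diagonal of length \<open>a\<close> meets the upper left block with
      \<open>r - m\<close> rows and \<open>s - m\<close> columns in \<open>a - m\<close> positions,
      so the exponents add up to the size of that block.\<close>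
    have "(\<Sum>d<r + s - 1. ?a d - m)
      = (\<Sum>d<r + s - 1. \<Sum>b<?a d. if r - 1 - d + b + m < r \<and> d - (r - 1) + b + m < s then 1 else 0)"
    proof (rule sum.cong)
      fix d
      have "(\<Sum>b<?a d. if b + m < ?a d then 1 else 0)
        = (\<Sum>b<?a d. if r - 1 - d + b + m < r \<and> d - (r - 1) + b + m < s then 1 else (0::nat))"
        by (rule sum.cong) (simp_all only: min_less_iff_conj less_diff_conv add_ac)
      then show "?a d - m
        = (\<Sum>b<?a d. if r - 1 - d + b + m < r \<and> d - (r - 1) + b + m < s then 1 else 0)"
        by (simp only: count)
    qed simp
    also have "\<dots> = (\<Sum>i<r. \<Sum>j<s. if i + m < r \<and> j + m < s then 1 else 0)"
      using diagonal_sum[of r s "\<lambda>i j. if i + m < r \<and> j + m < s then 1 else 0 :: nat"] m by simp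
    also have "\<dots> = (\<Sum>i<r. \<Sum>j<s. (if i + m < r then 1 else 0) * (if j + m < s then 1 else 0))"
      by (intro sum.cong) auto
    also have "\<dots> = (r - m) * (s - m)"
      by (simp only: sum_product[symmetric] count)
    finally show ?thesis .
  qed
  ultimately show ?thesis by simp
qed

text \<open>The leading exponent of the power is \<open>p - 1\<close> at every indeterminate, which
  is \<open>trace_monom p 0\<close>. The other exponents selected by the trace map are at least as
  heavy, so their coefficients vanish.\<close>

lemma trace_map_diagonal_product:
  assumes rs: "0 < r" "0 < s" and prime: "prime p" and char: "CHAR('k::field) = p"
    and \<kappa>: "inv_frobenius_linear p (\<kappa> :: 'k \<Rightarrow> 'k)" "\<kappa> 1 = 1"
  shows "trace_map p \<kappa> (diagonal_product ^ (p - 1) :: ('v \<Rightarrow>\<^sub>0 nat) \<Rightarrow>\<^sub>0 'k) = 1"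
proof (rule poly_mapping_eqI)
  fix n :: "'v \<Rightarrow>\<^sub>0 nat"
  note lookup = lookup_trace_map[OF prime char \<kappa>(1) finite_UNIV]
    lookup_trace_monom[OF prime char \<kappa>(1) finite_UNIV]
  let ?c = "scale_monom (p - 1) all_ones :: 'v \<Rightarrow>\<^sub>0 nat"
  have "has_lead weight ((\<Prod>i<p - 1. diagonal_product) :: ('v \<Rightarrow>\<^sub>0 nat) \<Rightarrow>\<^sub>0 'k) (\<Sum>i<p - 1. all_ones)"
    by (intro has_lead_prod weight_add weight_0 has_lead_diagonal_product rs)
  moreover have "(\<Sum>i<p - 1. all_ones) = ?c"
    by (rule poly_mapping_eqI) (simp add: lookup_sum lookup_scale_monom)
  ultimately have lead: "has_lead weight (diagonal_product ^ (p - 1) :: ('v \<Rightarrow>\<^sub>0 nat) \<Rightarrow>\<^sub>0 'k) ?c"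
    by simp
  show "Poly_Mapping.lookup (trace_map p \<kappa> (diagonal_product ^ (p - 1) :: ('v \<Rightarrow>\<^sub>0 nat) \<Rightarrow>\<^sub>0 'k)) n
      = Poly_Mapping.lookup 1 n"
  proof (cases "n = 0")
    case True
    have "trace_monom p 0 = ?c"
      by (rule poly_mapping_eqI)
        (simp add: lookup(2) lookup_scale_monom lookup_all_ones[OF finite_UNIV])
    then show ?thesis
      using has_lead_lookup(1)[OF lead] by (simp add: True lookup(1) \<kappa>(2) lookup_one)
  next
    case False
    then obtain v where v: "Poly_Mapping.lookup n v \<noteq> 0"
      by (metis lookup_zero poly_mapping_eqI)
    \<comment> \<open>Equality can occur, since entries of the first row and column have weight 0;
      \<open>has_lead_lookup\<close> also excludes other monomials of equal weight.\<close>
    have "weight ?c \<le> weight (trace_monom p n)"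
      by (rule weight_mono) (simp add: lookup(2) lookup_scale_monom lookup_all_ones[OF finite_UNIV])
    moreover have "trace_monom p n \<noteq> ?c"
    proof
      assume "trace_monom p n = ?c"
      then have "p * Poly_Mapping.lookup n v + (p - 1) = p - 1"
        using lookup(2)[of n v] by (simp add: lookup_scale_monom lookup_all_ones[OF finite_UNIV])
      then show False using v prime by (simp add: prime_gt_0_nat)
    qed
    ultimately have "Poly_Mapping.lookup (diagonal_product ^ (p - 1) :: ('v \<Rightarrow>\<^sub>0 nat) \<Rightarrow>\<^sub>0 'k) (trace_monom p n) = 0"
      by (rule has_lead_lookup(2)[OF lead])
    then show ?thesis
      using False by (simp add: lookup(1) inv_frobenius_linear_0[OF \<kappa>(1)] lookup_one)
  qed
qed

lemma symbolic_F_split_det_ideal: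
  assumes m: "m < r" "m < s" and prime: "prime p" and char: "CHAR('k::field) = p"
  shows "symbolic_F_split p (generic_det_ideal (Suc m) :: (('v \<Rightarrow>\<^sub>0 nat) \<Rightarrow>\<^sub>0 'k) set)"
proof -
  obtain \<kappa> :: "'k \<Rightarrow> 'k" where \<kappa>: "inv_frobenius_linear p \<kappa>" "\<kappa> 1 = 1"
    using ex_inv_frobenius_linear_field[OF prime char] by blast
  interpret mult_closed "- rank_ideal m :: (('v \<Rightarrow>\<^sub>0 nat) \<Rightarrow>\<^sub>0 'k) set"
    by (rule mult_closed_compl_rank_ideal)
  have T: "inv_frobenius_linear p (trace_map p \<kappa> :: (('v \<Rightarrow>\<^sub>0 nat) \<Rightarrow>\<^sub>0 'k) \<Rightarrow> _)"
    by (rule inv_frobenius_linear_trace_map[OF prime char \<kappa>(1) finite_UNIV])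
  show ?thesis
  proof (rule symbolic_F_splitI[OF prime _ T])
    show "CHAR(('v \<Rightarrow>\<^sub>0 nat) \<Rightarrow>\<^sub>0 'k) = p"
      by (rule CHAR_poly_mapping[OF prime char \<kappa>(1) finite_UNIV])
    show "trace_map p \<kappa> (diagonal_product ^ (p - 1) :: ('v \<Rightarrow>\<^sub>0 nat) \<Rightarrow>\<^sub>0 'k) = 1"
      using m by (intro trace_map_diagonal_product prime char \<kappa>) auto
    fix n and y :: "('v \<Rightarrow>\<^sub>0 nat) \<Rightarrow>\<^sub>0 'k"
    assume y: "y \<in> symbolic_power (generic_det_ideal (Suc m)) (n * p + 1)"
    have le: "m \<le> r" "m \<le> s" using m by simp_all
    have u: "gen_minor xi m id id ^ Suc m \<in> - (rank_ideal m :: (('v \<Rightarrow>\<^sub>0 nat) \<Rightarrow>\<^sub>0 'k) set)"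
      by (rule power_in) (simp add: leading_minor_notin_rank_ideal le)
    have f: "diagonal_product \<in> (det_symbolic_power m ((r - m) * (s - m)) :: (('v \<Rightarrow>\<^sub>0 nat) \<Rightarrow>\<^sub>0 'k) set)"
      by (rule diagonal_product_in_symbolic_power[OF m])
    have card: "card (bordered_generators m :: (('v \<Rightarrow>\<^sub>0 nat) \<Rightarrow>\<^sub>0 'k) set) \<le> (r - m) * (s - m)"
      by (rule card_bordered_generators)
    have G: "bordered_generators m \<subseteq> (generic_det_ideal (Suc m) :: (('v \<Rightarrow>\<^sub>0 nat) \<Rightarrow>\<^sub>0 'k) set)"
      by (rule bordered_generators_subset[OF le])
    have y': "y \<in> det_symbolic_power m (n * p + 1)"
      using y unfolding symbolic_power_det_ideal .
    show "trace_map p \<kappa> (diagonal_product ^ (p - 1) * y) \<in> symbolic_power (generic_det_ideal (Suc m)) (n + 1)"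
      unfolding symbolic_power_det_ideal
      by (rule inv_frobenius_linear_loc_pow[OF prime_gt_0_nat[OF prime] T type_ideal_det_ideal
            finite_bordered_generators card G u det_ideal_locally_generated[OF le] f y'])
  qed
qed

end

theorem theorem6p5:
  fixes r s t p :: nat
    and x :: "nat \<Rightarrow> nat \<Rightarrow> 'v::linorder"
    and Xmat :: "(('v \<Rightarrow>\<^sub>0 nat) \<Rightarrow>\<^sub>0 'k::field) mat"
  assumes "0 < r" and "r \<le> s"
    and "CHAR('k) = p" and "0 < p"
    and "F_finite p TYPE('k)"
    and "bij_betw (\<lambda>(i, j). x i j) ({..<r} \<times> {..<s}) UNIV"
    and "Xmat = mat r s (\<lambda>(i, j). indet (x i j))"
    and "1 \<le> t" and "t \<le> r"
  shows "symbolic_F_split p (det_ideal t Xmat)"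
proof -
  interpret matrix_indices r s x by unfold_locales fact
  have "prime p" using prime_CHAR_semidom[where ?'a = 'k] assms(3,4) by simp
  then have "symbolic_F_split p (generic_det_ideal (Suc (t - 1)) :: (('v \<Rightarrow>\<^sub>0 nat) \<Rightarrow>\<^sub>0 'k) set)"
    using assms by (intro symbolic_F_split_det_ideal) auto
  then show ?thesis using assms by simp
qed

end
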